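(* Let $h=h(r,s)=r-s+3/2$. If $0<h(r,s)<3/2$, then for any positive integer $n$, the $n$th Fourier coefficients of $\mathbb{K}_2(r,s)(\tau)$ and $\mathbb{K}_2(r,h)(\tau)$ are the same up to a sign. Moreover, if $(r,s)$ belongs to a Galois family, then the completed Hecke eigenforms satisfy $f_{r,s}=\chi_{r,h}\otimes f_{r,h}$, where $\chi_{r,h}$ is a finite order character.
   Context: Let $\eta$ be the Dedekind eta function. For rational $r,s$ with $0<r<s<3/2$ define $$\mathbb{K}_2(r,s)(\tau)=\frac{\eta(\tau/2)^{16s-8r-12}\,\eta(2\tau)^{8r+8s-12}}{\eta(\tau)^{24s-30}} .$$ If $r=a/b$ in lowest terms put $N=2b$ (this is $48/\gcd(24r,24)$ when $24r\in\mathbb{Z}$). The Fourier coefficients of $\mathbb{K}_2(r,s)(\tau)$ are taken with respect to $e^{2\pi i\tau/N}$. When no variable is written, $\mathbb{K}_2(r,s)$ means $\mathbb{K}_2(r,s)(N\tau)$, with expansion in $q=e^{2\pi i\tau}$. Let $\mathbb{S}_2'=\{(r,s)\in\mathbb{Q}^2 : 0<r<s<3/2,\ 24s\in\mathbb{Z},\ 8(r+s)\in\mathbb{Z}\}$; for these pairs $\mathbb{K}_2(r,s)$ is a weight 3 congruence cusp form. Let $M$ be the least common denominator of $1/2,r,s$. Pairs $(r,s)$ and $(r',s')$ are conjugate if there is an integer $c$ coprime to $M$ with $r-cr'\in\mathbb{Z}$ and $s-cs'\in\mathbb{Z}$. A family is the set of conjugates in $\mathbb{S}_2'$ of a given pair.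 A family $\{(r_i,s_i)\}_i$ is Galois if $r_i\ne r_j$ for $i\neq j$; it is then written $\{\mathbb{K}_2(i/b,s_i)\}_{i\in(\mathbb{Z}/b\mathbb{Z})^\times}$ (residues represented by $0<i<b$). For each Galois family with $r=1/b$, $s=s_1$, the completed Hecke eigenform is $f_{r,s}=\sum_{i}\beta_i\,\mathbb{K}_2(i/b,s_i)$ with $\beta_i\in\overline{\mathbb{Q}}$, $\beta_1=1$, an eigenvector of all Hecke operators $T_p$ with $p$ coprime to 6; the possible choices differ by twisting by quadratic characters of conductor dividing $b$, and one choice is fixed for each family. For a Dirichlet character $\chi$ and $f=\sum a_nq^n$, $\chi\otimes f=\sum\chi(n)a_nq^n$.
   Formalization: For the two Galois families with b=3 the twist identity fails (it would need χ(2)=±1 and χ(4)=-1); there it is replaced by a_n(f_{r,s})=χ(n)a_n(f_{r,h}) for odd n and a_n(f_{r,s})=-χ(n)a_n(f_{r,h}) for even n. *)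

theory Defs
  imports "HOL-Analysis.Analysis" "HOL-Computational_Algebra.Computational_Algebra"
begin

definition upper_half_plane :: "complex set" where
  "upper_half_plane = {\<tau>. Im \<tau> > 0}"


section \<open>Rational powers of the eta function and the functions \<open>\<bbbK>\<^sub>2(r, s)\<close>\<close>

definition dedekind_eta :: "complex \<Rightarrow> complex" where
  "dedekind_eta \<tau> =
     exp (2 * of_real pi * \<i> * \<tau> / 24) *
     (\<Prod>n. 1 - exp (2 * of_real pi * \<i> * of_nat (n + 1) * \<tau>))"

text \<open>
  For rational \<open>x\<close>, the power \<open>\<eta>\<^sup>x\<close> is \<open>exp (x log \<eta>)\<close> for the holomorphic logarithm of \<open>\<eta>\<close> on
  the upper half plane that is real on the imaginary axis. The factors \<open>1 - q\<^sup>n\<close> lie in the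
  right half plane, so the principal branch can be used factor by factor.
\<close>
definition eta_powr :: "rat \<Rightarrow> complex \<Rightarrow> complex" where
  "eta_powr x \<tau> =
     exp (2 * of_real pi * \<i> * of_rat x * \<tau> / 24) *
     (\<Prod>n. (1 - exp (2 * of_real pi * \<i> * of_nat (n + 1) * \<tau>)) powr of_rat x)"

lemma norm_exp_less_1_upper_half_plane:
  assumes "\<tau> \<in> upper_half_plane"
  shows "norm (exp (2 * of_real pi * \<i> * of_nat (n + 1) * \<tau>)) < 1"
  using assms by (simp add: upper_half_plane_def add_pos_nonneg mult_pos_pos)

lemma dedekind_eta_convergent_prod:
  assumes "\<tau> \<in> upper_half_plane"
  shows "convergent_prod (\<lambda>n. 1 - exp (2 * of_real pi * \<i> * of_nat (n + 1) * \<tau>))"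
proof -
  define q where "q = exp (2 * of_real pi * \<i> * \<tau>)"
  have q: "exp (2 * of_real pi * \<i> * of_nat (n + 1) * \<tau>) = q ^ (n + 1)" for n
    unfolding q_def exp_of_nat_mult[symmetric] by (simp add: algebra_simps)
  have "norm q < 1"
    using norm_exp_less_1_upper_half_plane[OF assms, of 0] by (simp add: q_def)
  then have "summable (\<lambda>n. norm q ^ Suc n)"
    by (subst summable_Suc_iff) (simp add: summable_geometric)
  then have "summable (\<lambda>n. norm ((1 - q ^ (n + 1)) - 1))"
    by (simp add: norm_mult norm_power)
  then have "abs_convergent_prod (\<lambda>n. 1 - q ^ (n + 1))"
    unfolding abs_convergent_prod_conv_summable .
  then show ?thesis
    unfolding q by (rule abs_convergent_prod_imp_convergent_prod)
qed

lemma eta_powr_of_int: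
  assumes "\<tau> \<in> upper_half_plane"
  shows "eta_powr (of_int k) \<tau> = dedekind_eta \<tau> powi k"
proof -
  define f where "f = (\<lambda>n. 1 - exp (2 * of_real pi * \<i> * of_nat (n + 1) * \<tau>))"
  have nz: "f n \<noteq> 0" for n
    unfolding f_def right_minus_eq
    by (metis norm_exp_less_1_upper_half_plane[OF assms, of n] norm_one less_irrefl)
  have conv: "convergent_prod f"
    unfolding f_def using assms by (rule dedekind_eta_convergent_prod)
  have "(\<Prod>n. f n powr of_int k) = (\<Prod>n. f n powi k)"
    using nz by (simp add: complex_powr_of_int)
  also have "\<dots> = (\<Prod>n. f n) powi k"
    using conv by (cases "k \<ge> 0")
      (simp_all add: power_int_def prodinf_power prodinf_inverse convergent_prod_power power_inverse[symmetric]
        convergent_prod_inverse)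
  finally have *: "(\<Prod>n. f n powr of_int k) = (\<Prod>n. f n) powi k" .
  have "exp (2 * of_real pi * \<i> * of_int k * \<tau> / 24) = exp (2 * of_real pi * \<i> * \<tau> / 24) powi k"
    by (simp add: exp_power_int algebra_simps)
  then show ?thesis
    using * by (simp add: eta_powr_def dedekind_eta_def f_def power_int_mult_distrib)
qed

definition K2 :: "rat \<Rightarrow> rat \<Rightarrow> complex \<Rightarrow> complex" where
  "K2 r s \<tau> =
     eta_powr (16 * s - 8 * r - 12) (\<tau> / 2) * eta_powr (8 * r + 8 * s - 12) (2 * \<tau>) /
     eta_powr (24 * s - 30) \<tau>"

definition rat_denom :: "rat \<Rightarrow> nat" where
  "rat_denom x = nat (snd (quotient_of x))"

definition K2_width :: "rat \<Rightarrow> nat" where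
  "K2_width r = 2 * rat_denom r"

definition K2_normalized :: "rat \<Rightarrow> rat \<Rightarrow> complex \<Rightarrow> complex" where
  "K2_normalized r s \<tau> = K2 r s (of_nat (K2_width r) * \<tau>)"


section \<open>Fourier expansions and twists\<close>

definition fourier_coeff :: "nat \<Rightarrow> (complex \<Rightarrow> complex) \<Rightarrow> nat \<Rightarrow> complex" where
  "fourier_coeff N f = (THE a. \<forall>\<tau>\<in>upper_half_plane.
     (\<lambda>n. a n * exp (2 * of_real pi * \<i> * of_nat n * \<tau> / of_nat N)) sums f \<tau>)"

text \<open>Every Dirichlet character has finite order.\<close>
definition dirichlet_character :: "nat \<Rightarrow> (int \<Rightarrow> complex) \<Rightarrow> bool" where
  "dirichlet_character m chi \<longleftrightarrow>
     m > 0 \<and> chi 1 = 1 \<and> (\<forall>a b. chi (a * b) = chi a * chi b) \<and>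
     (\<forall>a. chi (a + int m) = chi a) \<and> (\<forall>a. chi a = 0 \<longleftrightarrow> \<not> coprime a (int m))"

definition twist :: "(int \<Rightarrow> complex) \<Rightarrow> (complex \<Rightarrow> complex) \<Rightarrow> complex \<Rightarrow> complex" where
  "twist chi f \<tau> =
     (\<Sum>n. chi (int n) * fourier_coeff 1 f n * exp (2 * of_real pi * \<i> * of_nat n * \<tau>))"

text \<open>
  The twisting identity between completed eigenforms needs a sign at even \<open>n\<close> in one case. The
  families of \<open>(1/3, 2/3)\<close> and \<open>(1/3, 7/6)\<close>, the only Galois families with \<open>b = 3\<close>, have the
  eigenforms \<open>q + u q\<^sup>2 + 4 q\<^sup>4 - 4 u q\<^sup>5 + \<dots>\<close> and \<open>q + v q\<^sup>2 - 4 q\<^sup>4 + 4 v q\<^sup>5 + \<dots>\<close> with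
  \<open>u, v \<in> {2, -2}\<close>. A character \<open>chi\<close> twisting the second form exactly into the first one would
  satisfy \<open>chi 2 = u / v\<close> and \<open>chi 4 = -1\<close>, which is impossible. The coefficients at odd \<open>n\<close> are
  related by a character mod 3, and those at even \<open>n\<close> by its negative. For all other \<open>b\<close>
  there is no such obstruction: either \<open>b\<close> is even and only odd \<open>n\<close> occur, or \<open>b = 1\<close> and the two
  forms coincide.
\<close>


section \<open>Cusp forms and Hecke operators\<close>

text \<open>
  The space \<open>S\<^sub>k(\<Gamma>\<^sub>0(L), eps)\<close>. In the last clause the matrix ranges over all of \<open>SL\<^sub>2(\<int>)\<close>, so that
  the form vanishes at every cusp.
\<close>
definition cusp_form :: "nat \<Rightarrow> nat \<Rightarrow> (int \<Rightarrow> complex) \<Rightarrow> (complex \<Rightarrow> complex) \<Rightarrow> bool" where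
  "cusp_form k L eps f \<longleftrightarrow>
     f holomorphic_on upper_half_plane \<and>
     (\<forall>a b c d :: int. a * d - b * c = 1 \<and> int L dvd c \<longrightarrow>
        (\<forall>\<tau>\<in>upper_half_plane.
           f ((of_int a * \<tau> + of_int b) / (of_int c * \<tau> + of_int d)) =
             eps d * (of_int c * \<tau> + of_int d) ^ k * f \<tau>)) \<and>
     (\<forall>a b c d :: int. a * d - b * c = 1 \<longrightarrow>
        (\<forall>e>0. \<exists>B>0. \<forall>\<tau>. Im \<tau> > B \<longrightarrow>
           norm (f ((of_int a * \<tau> + of_int b) / (of_int c * \<tau> + of_int d)) /
                 (of_int c * \<tau> + of_int d) ^ k) < e))"

text \<open>
  On \<open>S\<^sub>k(\<Gamma>\<^sub>0(L), eps)\<close>. On Fourier coefficients this is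
  \<open>a\<^sub>n \<mapsto> a\<^sub>p\<^sub>n + eps(p) p\<^bsup>k-1\<^esup> a\<^bsub>n/p\<^esub>\<close>.
\<close>
definition hecke_op ::
    "nat \<Rightarrow> (int \<Rightarrow> complex) \<Rightarrow> nat \<Rightarrow> (complex \<Rightarrow> complex) \<Rightarrow> complex \<Rightarrow> complex" where
  "hecke_op k eps p f \<tau> =
     (\<Sum>j<p. f ((\<tau> + of_nat j) / of_nat p)) / of_nat p +
     eps (int p) * of_nat p ^ (k - 1) * f (of_nat p * \<tau>)"

text \<open>
  The level is only divisible by the primes 2 and 3, so that every \<open>T\<^sub>p\<close> with \<open>p\<close> coprime to 6
  is a Hecke operator at a prime not dividing the level.
\<close>
definition hecke_eigenform_away_from_6 :: "nat \<Rightarrow> (complex \<Rightarrow> complex) \<Rightarrow> bool" where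
  "hecke_eigenform_away_from_6 k f \<longleftrightarrow>
     (\<exists>L eps. (\<forall>p. prime p \<and> p dvd L \<longrightarrow> p = 2 \<or> p = 3) \<and>
        dirichlet_character L eps \<and> cusp_form k L eps f \<and>
        (\<exists>\<tau>\<in>upper_half_plane. f \<tau> \<noteq> 0) \<and>
        (\<forall>p. prime p \<and> coprime p 6 \<longrightarrow>
           (\<exists>c. \<forall>\<tau>\<in>upper_half_plane. hecke_op k eps p f \<tau> = c * f \<tau>)))"


section \<open>Families of conjugates and completed eigenforms\<close>

definition S2' :: "(rat \<times> rat) set" where
  "S2' = {(r, s). 0 < r \<and> r < s \<and> s < 3 / 2 \<and> 24 * s \<in> \<int> \<and> 8 * (r + s) \<in> \<int>}"

definition pair_denom :: "rat \<times> rat \<Rightarrow> nat" where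
  "pair_denom p = lcm 2 (lcm (rat_denom (fst p)) (rat_denom (snd p)))"

text \<open>
  The multiplier is a unit modulo the common denominator of either pair. Coprimality to only one
  of the two would not give a symmetric relation, as \<open>1/2 - 3 \<cdot> 1/6\<close> is an integer.
\<close>
definition conjugate_pairs :: "rat \<times> rat \<Rightarrow> rat \<times> rat \<Rightarrow> bool" where
  "conjugate_pairs p p' \<longleftrightarrow>
     (\<exists>c::int. coprime c (int (pair_denom p)) \<and> coprime c (int (pair_denom p')) \<and>
        fst p - of_int c * fst p' \<in> \<int> \<and> snd p - of_int c * snd p' \<in> \<int>)"

definition conj_family :: "rat \<times> rat \<Rightarrow> (rat \<times> rat) set" where
  "conj_family p = {p' \<in> S2'. conjugate_pairs p p'}"

definition galois_family :: "(rat \<times> rat) set \<Rightarrow> bool" where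
  "galois_family F \<longleftrightarrow> (\<exists>p\<in>S2'. F = conj_family p) \<and> inj_on fst F"

text \<open>
  The members of a Galois family \<open>F\<close> are the \<open>(i/b, s\<^sub>i)\<close>; the sum is indexed by the members
  themselves. The coefficients are not unique (quadratic twists remain possible), so this is a
  predicate satisfied by every admissible choice.
\<close>
definition completed_eigenform :: "(rat \<times> rat) set \<Rightarrow> (complex \<Rightarrow> complex) \<Rightarrow> bool" where
  "completed_eigenform F f \<longleftrightarrow>
     (\<exists>\<beta> :: rat \<times> rat \<Rightarrow> complex.
        (\<forall>p\<in>F. algebraic (\<beta> p)) \<and>
        (\<exists>(b::nat) s\<^sub>1. b > 0 \<and> (1 / of_nat b, s\<^sub>1) \<in> F \<and> \<beta> (1 / of_nat b, s\<^sub>1) = 1) \<and>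
        (\<forall>\<tau>\<in>upper_half_plane. f \<tau> = (\<Sum>p\<in>F. \<beta> p * K2_normalized (fst p) (snd p) \<tau>)) \<and>
        hecke_eigenform_away_from_6 3 f)"

end

theory Submission
  imports Defs "HOL-Complex_Analysis.Complex_Analysis"
begin

text \<open>
  Put \<open>x = e\<^sup>\<pi>\<^sup>i\<^sup>\<tau>\<close> and \<open>L(x) = \<Sum>\<^sub>n log (1 - x\<^sup>n)\<close>. Then \<open>\<bbbK>\<^sub>2(r, s)\<close> is \<open>e\<^sup>\<pi>\<^sup>i\<^sup>r\<^sup>\<tau>\<close> times the
  exponential of a combination of \<open>L(x)\<close>, \<open>L(x\<^sup>2)\<close> and \<open>L(x\<^sup>4)\<close>. The identity
  \<open>L(-x) = 3 L(x\<^sup>2) - L(x) - L(x\<^sup>4)\<close>, which is the formula for \<open>\<eta>((\<tau> + 1)/2)\<close> in terms of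
  \<open>\<eta>(\<tau>/2)\<close>, \<open>\<eta>(\<tau>)\<close> and \<open>\<eta>(2\<tau>)\<close>, exchanges the exponents of \<open>(r, s)\<close> and \<open>(r, h)\<close>. So the
  coefficient of \<open>x\<^sup>k\<close> changes by the factor \<open>(-1)\<^sup>k\<close> (\<open>K2_coeff_reflect\<close>), which is the first
  claim.

  For the second claim let \<open>f\<close> and \<open>f'\<close> be completed eigenforms of the two families, with
  coefficients \<open>a\<close> and \<open>a'\<close>, and let \<open>r\<close> have denominator \<open>b\<close>. The member with \<open>r = i/b\<close> lives on
  the exponents \<open>n \<equiv> i\<close> modulo \<open>b\<close>. Therefore \<open>a(n) = \<psi>(n) a'(n)\<close> with
  \<open>\<psi>(n) = (\<beta>\<^sub>i / \<beta>'\<^sub>i) (-1)\<^bsup>\<lfloor>n/b\<rfloor>\<^esup>\<close>, and the point is that \<open>\<psi>\<close> is multiplicative on the units if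
  \<open>b\<close> is even. If \<open>p > 3\<close> is a prime not dividing \<open>n\<close>, then \<open>a(p n) = a(p) a(n)\<close> because \<open>f\<close> is an
  eigenform of \<open>T\<^sub>p\<close>, and likewise for \<open>a'\<close>. Hence \<open>\<psi>(p n) = \<psi>(p) \<psi>(n)\<close> whenever \<open>a(p)\<close> and \<open>a(n)\<close>
  do not vanish (\<open>psi_mult_at_prime\<close>). Since \<open>\<psi>\<close> depends on \<open>n\<close> modulo \<open>2b\<close> only, suitable small
  \<open>p\<close> and \<open>n\<close> are enough, and \<open>p\<close> needs to run only through generators of the group of classes
  that occur.

  What remains is that the coefficients \<open>\<beta>\<^sub>i\<close> do not vanish, and this uses numbers. Every Galois
  family is one of 21 (\<open>galois_rep\<close>). For a prime \<open>p\<close> in the class of \<open>i\<close> and an \<open>n\<close> with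
  \<open>p n \<equiv> 1\<close> modulo \<open>b\<close>, the coefficient \<open>a(p n)\<close> is one of \<open>\<bbbK>\<^sub>2(1/b, s\<^sub>1)\<close>, independent of \<open>\<beta>\<close>. If
  it is not zero, then neither is \<open>a(p) = \<beta>\<^sub>i c\<close>. At most three such coefficients are needed for a
  family, and the remaining classes are products of those (\<open>u_nonzero_of_generating_data\<close>).

  In four families only half of the units modulo \<open>b\<close> occur as classes, one from each pair \<open>\<plusminus>i\<close>.
  There \<open>\<psi>\<close> is extended by \<open>\<psi>(-n) = \<psi>(n)\<close>. For \<open>b = 3\<close> the even \<open>n\<close> behave differently from the
  odd ones and the character is written down directly; for \<open>b = 1\<close> both families consist of
  \<open>(1, 5/4)\<close> alone.
\<close>


section \<open>The logarithm of the Euler product\<close>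

definition divisor_sum :: "nat \<Rightarrow> nat" where
  "divisor_sum n = (\<Sum>d | d dvd n \<and> n > 0. d)"

lemma divisor_sum_le: "divisor_sum n \<le> n * n"
proof -
  have "divisor_sum n \<le> (\<Sum>d\<in>{1..n}. n)"
    unfolding divisor_sum_def
    by (rule order.trans[OF sum_mono sum_mono2])
       (auto simp: dvd_imp_le intro: Suc_leI dvd_pos_nat)
  then show ?thesis by simp
qed

definition log_euler :: "complex \<Rightarrow> complex" where
  "log_euler x = (\<Sum>n. Ln (1 - x ^ (n + 1)))"

text \<open>
  Both claims come from the absolutely convergent double sum of \<open>- x\<^bsup>nm\<^esup> / m\<close>: summing over \<open>m\<close>
  first gives \<open>Ln (1 - x\<^sup>n)\<close>, and collecting the terms with \<open>n m = j\<close> gives the Lambert series.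
\<close>
lemma
  fixes x :: complex
  assumes x: "norm x < 1"
  shows summable_log_euler: "summable (\<lambda>n. Ln (1 - x ^ (n + 1)))"
    and log_euler_sums: "(\<lambda>j. - of_nat (divisor_sum j) / of_nat j * x ^ j) sums log_euler x"
proof -
  define D where "D = (SIGMA j:{0<..}. {d::nat. d dvd j})"
  \<comment> \<open>The pair \<open>(j, d)\<close> stands for \<open>n = d\<close> and \<open>m = j / d\<close>.\<close>
  define g where "g = (\<lambda>(j::nat, d::nat). - (of_nat d / of_nat j * x ^ j))"
  have fin: "finite {d. d dvd j}" if "j \<in> {0<..}" for j :: nat
    using that by simp
  have norm_fibre: "(\<Sum>\<^sub>\<infinity>d\<in>{d. d dvd j}. norm (g (j, d))) \<le> of_nat j * norm x ^ j"
    if "j \<in> {0<..}" for j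
  proof -
    have "(\<Sum>\<^sub>\<infinity>d\<in>{d. d dvd j}. norm (g (j, d))) = of_nat (divisor_sum j) / of_nat j * norm x ^ j"
      using that fin[OF that]
      by (simp add: g_def norm_mult norm_divide norm_power divisor_sum_def sum_distrib_right sum_divide_distrib)
    also have "\<dots> \<le> of_nat (j * j) / of_nat j * norm x ^ j"
      using divisor_sum_le[of j]
      by (intro mult_right_mono divide_right_mono of_nat_mono) auto
    finally show ?thesis using that by simp
  qed
  have "summable (\<lambda>j. of_nat j * norm x ^ j :: real)"
    using sums_summable[OF sums_mult[OF geometric_deriv_sums[of "norm x"], of "norm x"]] x
    by (subst summable_Suc_iff[symmetric]) (simp add: mult_ac)
  then have S: "(\<lambda>j. of_nat j * norm x ^ j :: real) summable_on {0<..}"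
    by (intro summable_on_subset_banach[OF summable_nonneg_imp_summable_on]) auto
  have "(\<lambda>j. \<Sum>\<^sub>\<infinity>d\<in>{d. d dvd j}. norm (g (j, d))) summable_on {0<..}"
    by (rule summable_on_comparison_test[OF S norm_fibre]) (auto intro: sum_nonneg infsum_nonneg)
  then have "(\<lambda>p. norm (g p)) summable_on D"
    unfolding D_def using fin
    by (intro Infinite_Sum.abs_summable_on_Sigma_iff[THEN iffD2])
       (simp add: infsum_nonneg abs_of_nonneg sum_nonneg)
  then have g: "g summable_on D" by (rule abs_summable_summable)
  define T where "T = infsum g D"
  have gT: "(g has_sum T) D" using g by (simp add: T_def)
  have "((\<lambda>j. - of_nat (divisor_sum j) / of_nat j * x ^ j) has_sum T) {0<..}"
  proof (rule has_sum_SigmaD[OF gT[unfolded D_def]])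
    fix j :: nat assume j: "j \<in> {0<..}"
    have "((\<lambda>d. g (j, d)) has_sum (\<Sum>d | d dvd j. g (j, d))) {d. d dvd j}"
      using fin[OF j] by (rule has_sum_finite)
    also have "(\<Sum>d | d dvd j. g (j, d)) = - of_nat (divisor_sum j) / of_nat j * x ^ j"
      using j by (simp add: g_def divisor_sum_def sum_distrib_right sum_divide_distrib sum_negf)
    finally show "((\<lambda>d. g (j, d)) has_sum - of_nat (divisor_sum j) / of_nat j * x ^ j) {d. d dvd j}" .
  qed
  then have "((\<lambda>j. - of_nat (divisor_sum j) / of_nat j * x ^ j) has_sum T) UNIV"
    by (subst has_sum_cong_neutral[where T = "{0<..}" and g = "\<lambda>j. - of_nat (divisor_sum j) / of_nat j * x ^ j"]) auto
  then have 1: "(\<lambda>j. - of_nat (divisor_sum j) / of_nat j * x ^ j) sums T"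
    by (rule has_sum_imp_sums)
  have "((\<lambda>(n, m). - (x ^ (Suc n * Suc m) / of_nat (Suc m))) has_sum T) (UNIV \<times> UNIV)"
    using gT
    by (rule iffD1[OF has_sum_reindex_bij_witness[where 
        i = "\<lambda>(n, m). (Suc n * Suc m, Suc n)" and j = "\<lambda>(j, d). (d - 1, j div d - 1)"], rotated -1])
       (auto simp: D_def g_def field_simps simp del: of_nat_Suc mult_Suc mult_Suc_right power_Suc elim!: dvdE)
  then have 2: "((\<lambda>n. Ln (1 - x ^ (n + 1))) has_sum T) UNIV"
  proof (rule has_sum_SigmaD)
    fix n :: nat
    have nx: "norm (x ^ Suc n) < 1" using x by (simp add: norm_power power_less_one_iff del: power_Suc)
    have "((\<lambda>m. - (x ^ (Suc n * Suc m) / of_nat (Suc m))) has_sum Ln (1 - x ^ (n + 1))) UNIV"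
    proof (rule norm_summable_imp_has_sum)
      show "summable (\<lambda>m. norm (- (x ^ (Suc n * Suc m) / of_nat (Suc m))))"
      proof (rule summable_comparison_test)
        show "summable (\<lambda>m. norm (x ^ Suc n) * norm (x ^ Suc n) ^ m)"
          using nx by (intro summable_mult summable_geometric) simp
        show "\<exists>N. \<forall>m\<ge>N. norm (norm (- (x ^ (Suc n * Suc m) / of_nat (Suc m)))) \<le> norm (x ^ Suc n) * norm (x ^ Suc n) ^ m"
        proof (intro exI[of _ 0] allI impI)
          fix m :: nat
          have "norm (- (x ^ (Suc n * Suc m) / of_nat (Suc m))) = norm (x ^ Suc n) * norm (x ^ Suc n) ^ m / of_nat (Suc m)"
            by (subst power_mult) (simp add: norm_divide norm_power norm_mult del: of_nat_Suc)
          also have "\<dots> \<le> norm (x ^ Suc n) * norm (x ^ Suc n) ^ m / 1"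
            by (rule divide_left_mono) auto
          finally show "norm (norm (- (x ^ (Suc n * Suc m) / of_nat (Suc m)))) \<le> norm (x ^ Suc n) * norm (x ^ Suc n) ^ m"
            by simp
        qed
      qed
      have "(\<lambda>m. - ((x ^ Suc n) ^ m) / of_nat m) sums Ln (1 - x ^ (n + 1))"
        using Ln_series'[of "- (x ^ Suc n)"] nx by simp
      from sums_split_initial_segment[OF this, of 1]
      show "(\<lambda>m. - (x ^ (Suc n * Suc m) / of_nat (Suc m))) sums Ln (1 - x ^ (n + 1))"
        by (simp add: power_mult del: of_nat_Suc mult_Suc mult_Suc_right power_Suc)
    qed
    then show "((\<lambda>m. case (n, m) of (n, m) \<Rightarrow> - (x ^ (Suc n * Suc m) / of_nat (Suc m))) 
        has_sum Ln (1 - x ^ (n + 1))) UNIV" by simp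
  qed
  then have 3: "(\<lambda>n. Ln (1 - x ^ (n + 1))) sums T" by (rule has_sum_imp_sums)
  then show "summable (\<lambda>n. Ln (1 - x ^ (n + 1)))" by (rule sums_summable)
  from 1 3 show "(\<lambda>j. - of_nat (divisor_sum j) / of_nat j * x ^ j) sums log_euler x"
    by (simp add: log_euler_def sums_iff)
qed

text \<open>
  The numbers \<open>1 - y\<close> and \<open>1 + y\<close> lie in the right half plane, so that their arguments add up to
  less than \<open>\<pi>\<close> in absolute value and the principal logarithm is additive.
\<close>
lemma Ln_one_minus_square:
  assumes "norm y < 1"
  shows "Ln (1 - y ^ 2) = Ln (1 - y) + Ln (1 + y)"
proof -
  have pos: "Re (1 - y) > 0" "Re (1 + y) > 0"
    using assms abs_Re_le_cmod[of y] by auto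
  then have "\<bar>Im (Ln (1 - y))\<bar> < pi / 2" "\<bar>Im (Ln (1 + y))\<bar> < pi / 2"
    by (metis Re_Ln_pos_lt less_numeral_extra(3) zero_complex.simps(1))+
  then have "Ln ((1 - y) * (1 + y)) = Ln (1 - y) + Ln (1 + y)"
    using pos by (intro Ln_times_simple) (auto simp: complex_eq_iff)
  then show ?thesis by (simp add: power2_eq_square algebra_simps)
qed

lemma sums_multiples_iff:
  fixes f :: "nat \<Rightarrow> 'a :: real_normed_vector"
  assumes "k > 0"
  shows "(\<lambda>n. if k dvd n then f n else 0) sums s \<longleftrightarrow> (\<lambda>n. f (k * n)) sums s"
proof -
  have "strict_mono ((*) k)" using assms by (simp add: strict_mono_def)
  from sums_mono_reindex[OF this, of "\<lambda>n. if k dvd n then f n else 0" s]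
  show ?thesis by (auto simp: image_iff dvd_def)
qed

lemma sums_odd_iff:
  fixes f :: "nat \<Rightarrow> 'a :: real_normed_vector"
  shows "(\<lambda>n. if odd n then f n else 0) sums s \<longleftrightarrow> (\<lambda>n. f (2 * n + 1)) sums s"
proof -
  have "strict_mono (\<lambda>n::nat. 2 * n + 1)" by (simp add: strict_mono_def)
  from sums_mono_reindex[OF this, of "\<lambda>n. if odd n then f n else 0" s]
  moreover have "(if odd n then f n else 0) = 0" if "n \<notin> range (\<lambda>n. 2 * n + 1)" for n
    using that by (auto elim!: oddE)
  ultimately show ?thesis by simp
qed

text \<open>
  This is the logarithm of \<open>\<eta>((\<tau> + 1)/2) \<eta>(\<tau>/2) \<eta>(2\<tau>) = const \<eta>(\<tau>)\<^sup>3\<close>. The factors with even \<open>n\<close>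
  are unchanged by \<open>x \<mapsto> -x\<close>, and for odd \<open>n\<close> the factors at \<open>x\<close> and \<open>-x\<close> multiply to \<open>1 - x\<^bsup>2n\<^esup>\<close>.
\<close>
lemma log_euler_minus:
  assumes x: "norm x < 1"
  shows "log_euler (- x) = 3 * log_euler (x ^ 2) - log_euler x - log_euler (x ^ 4)"
proof -
  have sums: "(\<lambda>n. Ln (1 - y ^ (n + 1))) sums log_euler y" if "norm y < 1" for y
    using summable_log_euler[OF that] by (simp add: log_euler_def sums_iff)
  have x2: "norm (x ^ 2) < 1" and x4: "norm (x ^ 4) < 1" and xm: "norm (- x) < 1"
    using x by (auto simp: norm_power power_less_one_iff)
  have odd: "(\<lambda>n. Ln (1 - y ^ (2 * n + 1))) sums (log_euler y - log_euler (y ^ 2))" if y: "norm y < 1" for y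
  proof -
    have "norm (y ^ 2) < 1" using y by (auto simp: norm_power power_less_one_iff)
    from sums[OF this] have "(\<lambda>n. Ln (1 - y ^ (2 * n + 1 + 1))) sums log_euler (y ^ 2)"
      by (simp add: power_mult[symmetric] del: power_Suc)
    then have e: "(\<lambda>n. if odd n then Ln (1 - y ^ (n + 1)) else 0) sums log_euler (y ^ 2)"
      using sums_odd_iff[of "\<lambda>n. Ln (1 - y ^ (n + 1))"] by simp
    from sums_diff[OF sums[OF y] e]
    have "(\<lambda>n. if even n then Ln (1 - y ^ (n + 1)) else 0) sums (log_euler y - log_euler (y ^ 2))"
      by (rule sums_cong[THEN iffD1, rotated]) auto
    then show ?thesis
      using sums_multiples_iff[of 2 "\<lambda>n. Ln (1 - y ^ (n + 1))"] by simp
  qed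
  have "(\<lambda>n. Ln (1 - (x ^ 2) ^ (2 * n + 1))) sums
          ((log_euler x - log_euler (x ^ 2)) + (log_euler (- x) - log_euler ((- x) ^ 2)))"
  proof (rule sums_cong[THEN iffD1, rotated, OF sums_add[OF odd[OF x] odd[OF xm]]])
    fix n
    have "norm (x ^ (2 * n + 1)) < 1" using x by (simp add: norm_power power_less_one_iff del: power_Suc)
    from Ln_one_minus_square[OF this]
    show "Ln (1 - x ^ (2 * n + 1)) + Ln (1 - (- x) ^ (2 * n + 1)) = Ln (1 - (x ^ 2) ^ (2 * n + 1))"
      by (simp add: power_mult_distrib power_mult[symmetric] power2_eq_square power_add[symmetric] mult_2[symmetric]
          mult.commute[of 2] del: power_Suc)
  qed
  from sums_unique2[OF this odd[OF x2]] show ?thesis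
    by (simp add: power_mult[symmetric] algebra_simps)
qed

section \<open>Exponentials of power series\<close>

text \<open>
  The coefficients of \<open>exp (\<Sum>\<^sub>n w\<^sub>n x\<^sup>n / n)\<close> satisfy \<open>(n + 1) c\<^sub>n\<^sub>+\<^sub>1 = \<Sum>\<^sub>i\<^sub>\<le>\<^sub>n w\<^sub>i\<^sub>+\<^sub>1 c\<^sub>n\<^sub>-\<^sub>i\<close>.
  The list holds \<open>c\<^sub>n, \<dots>, c\<^sub>0\<close> in this order, so that the recursion needs only the previous list.
\<close>
primrec exp_coeffs :: "(nat \<Rightarrow> rat) \<Rightarrow> nat \<Rightarrow> rat list" where
  "exp_coeffs w 0 = [1]"
| "exp_coeffs w (Suc n) =
     (let cs = exp_coeffs w n
      in (\<Sum>(j, c)\<leftarrow>zip [1..<n + 2] cs. w j * c) / of_nat (Suc n) # cs)"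

definition exp_coeff :: "(nat \<Rightarrow> rat) \<Rightarrow> nat \<Rightarrow> rat" where
  "exp_coeff w n = hd (exp_coeffs w n)"

lemma exp_coeffs_eq: "exp_coeffs w n = map (\<lambda>i. exp_coeff w (n - i)) [0..<Suc n]"
proof (induction n)
  case (Suc n)
  have "exp_coeffs w (Suc n) = exp_coeff w (Suc n) # exp_coeffs w n"
    by (simp add: exp_coeff_def Let_def)
  also have "\<dots> = map (\<lambda>i. exp_coeff w (Suc n - i)) (0 # map Suc [0..<Suc n])"
    by (subst Suc.IH) simp
  also have "0 # map Suc [0..<Suc n] = [0..<Suc (Suc n)]"
    by (simp add: map_Suc_upt upt_conv_Cons del: upt_Suc)
  finally show ?case .
qed (simp add: exp_coeff_def)

lemma exp_coeff_0 [simp]: "exp_coeff w 0 = 1"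
  by (simp add: exp_coeff_def)

lemma exp_coeff_Suc:
  "of_nat (Suc n) * exp_coeff w (Suc n) = (\<Sum>i\<le>n. w (Suc i) * exp_coeff w (n - i))"
proof -
  have "of_nat (Suc n) * exp_coeff w (Suc n) = (\<Sum>(j, c)\<leftarrow>zip [1..<n + 2] (exp_coeffs w n). w j * c)"
    by (simp add: exp_coeff_def Let_def del: upt_Suc of_nat_Suc)
  also have "zip [1..<n + 2] (exp_coeffs w n) = map (\<lambda>i. (Suc i, exp_coeff w (n - i))) [0..<Suc n]"
    by (subst exp_coeffs_eq) (rule nth_equalityI, simp_all del: upt_Suc)
  also have "(\<Sum>(j, c)\<leftarrow>\<dots>. w j * c) = (\<Sum>i\<leftarrow>[0..<Suc n]. w (Suc i) * exp_coeff w (n - i))"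
    by (simp add: o_def del: upt_Suc)
  also have "\<dots> = (\<Sum>i\<le>n. w (Suc i) * exp_coeff w (n - i))"
    by (simp add: sum_list_distinct_conv_sum_set atLeast0LessThan lessThan_Suc_atMost del: upt_Suc)
  finally show ?thesis .
qed

text \<open>
  The exponential \<open>G\<close> of a power series \<open>H\<close> solves \<open>G' = H' G\<close>, and comparing coefficients gives
  \<open>exp_coeff_Suc\<close>. Convergence in the whole disc holds because \<open>G\<close> is holomorphic there.
\<close>
lemma exp_power_series:
  fixes h :: "complex \<Rightarrow> complex"
  assumes h: "\<And>x. norm x < 1 \<Longrightarrow> (\<lambda>n. of_rat (w n) / of_nat n * x ^ n) sums h x"
    and x: "norm x < 1"
  shows "(\<lambda>n. of_rat (exp_coeff w n) * x ^ n) sums exp (h x)"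
proof -
  define H where "H = Abs_fps (\<lambda>n. of_rat (w n) / of_nat n :: complex)"
  have H: "eval_fps H y = h y" if "norm y < 1" for y
    using h[OF that] by (simp add: H_def eval_fps_def sums_iff)
  have "fps_conv_radius H \<ge> ereal 1"
    unfolding fps_conv_radius_def
    by (rule conv_radius_geI_ex') (use h in \<open>auto simp: H_def sums_iff\<close>)
  then have rad: "ereal (norm y) < fps_conv_radius H" if "norm y < 1" for y :: complex
    using that by (meson less_ereal.simps(1) order.strict_trans2)
  then have holo_H: "eval_fps H holomorphic_on ball 0 1"
    by (intro holomorphic_on_eval_fps) auto
  have exp_H: "h has_fps_expansion H"
    unfolding has_fps_expansion_def
    using rad[of 0] eventually_nhds_in_open[of "ball 0 1" "0 :: complex"]
    by (auto elim!: eventually_mono simp: H zero_ereal_def)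
  have hol: "h holomorphic_on ball 0 1"
    by (rule holomorphic_transform[OF holo_H]) (auto simp: H)
  then have hol_exp: "(\<lambda>y. exp (h y)) holomorphic_on eball 0 1"
    unfolding one_ereal_def eball_ereal by (intro holomorphic_intros)
  define G where "G = fps_expansion (\<lambda>y. exp (h y)) 0"
  have exp_G: "(\<lambda>y. exp (h y)) has_fps_expansion G"
    unfolding G_def
    by (rule has_fps_expansion_fps_expansion[of "ball 0 1"]) (use hol in \<open>auto intro!: holomorphic_intros\<close>)
  have prod: "(\<lambda>y. deriv h y * exp (h y)) has_fps_expansion fps_deriv H * G"
    by (intro has_fps_expansion_mult has_fps_expansion_deriv exp_H exp_G)
  have "deriv (\<lambda>y. exp (h y)) y = deriv h y * exp (h y)" if "y \<in> ball 0 1" for y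
    using holomorphic_derivI[OF hol open_ball that] that
    by (intro DERIV_imp_deriv) (auto intro!: derivative_eq_intros)
  then have "\<forall>\<^sub>F y in nhds 0. deriv (\<lambda>y. exp (h y)) y = deriv h y * exp (h y)"
    using eventually_nhds_in_open[of "ball 0 1" "0 :: complex"] by (auto elim: eventually_mono)
  from has_fps_expansion_cong[OF this refl, THEN iffD1, OF has_fps_expansion_deriv[OF exp_G]] prod
  have ode: "fps_deriv G = fps_deriv H * G"
    by (rule fps_expansion_unique_complex)
  have h0: "h 0 = 0"
    using h[of 0] sums_unique2[OF powser_sums_zero, of "\<lambda>n. of_rat (w n) / of_nat n :: complex" "h 0"] by simp
  have "fps_nth G n = of_rat (exp_coeff w n)" for n
  proof (induction n rule: less_induct)
    case (less n)
    show ?case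
    proof (cases n)
      case 0
      then show ?thesis
        using has_fps_expansion_imp_0_eq_fps_nth_0[OF exp_G] h0 by simp
    next
      case (Suc m)
      have "of_nat (Suc m) * fps_nth G (Suc m) = fps_nth (fps_deriv H * G) m"
        by (simp flip: ode)
      also have "\<dots> = (\<Sum>i\<le>m. of_rat (w (Suc i)) * of_rat (exp_coeff w (m - i)))"
        using less by (simp add: fps_mult_nth H_def Suc atMost_atLeast0 del: of_nat_Suc)
      also have "\<dots> = of_rat (of_nat (Suc m) * exp_coeff w (Suc m))"
        by (subst exp_coeff_Suc) (simp add: of_rat_sum of_rat_mult)
      finally show ?thesis
        by (simp add: Suc of_rat_mult del: of_nat_Suc)
    qed
  qed
  then show ?thesis
    using has_fps_expansion_imp_sums_complex[OF exp_G hol_exp, of x] x by simp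
qed

section \<open>Uniqueness of Fourier expansions\<close>

text \<open>
  Values of \<open>e\<^bsup>2\<pi>i\<tau>/N\<^esup>\<close> are never 0, hence the punctured disc in the hypotheses. The difference of
  the two series vanishes at 0 as well, by continuity.
\<close>
lemma power_series_unique:
  fixes a b :: "nat \<Rightarrow> complex"
  assumes "\<And>x. 0 < norm x \<Longrightarrow> norm x < 1 \<Longrightarrow> (\<lambda>n. a n * x ^ n) sums f x"
    and "\<And>x. 0 < norm x \<Longrightarrow> norm x < 1 \<Longrightarrow> (\<lambda>n. b n * x ^ n) sums f x"
  shows "a = b"
proof -
  define F where "F = Abs_fps (\<lambda>n. a n - b n)"
  have F: "(\<lambda>n. fps_nth F n * x ^ n) sums 0" if "0 < norm x" "norm x < 1" for x
    using sums_diff[OF assms(1)[OF that] assms(2)[OF that]] by (simp add: F_def algebra_simps)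
  have "summable (\<lambda>n. fps_nth F n * (1 / 2) ^ n)"
    using F[of "1 / 2"] by (auto simp: sums_iff)
  then have "norm (1 / 2 :: complex) \<le> fps_conv_radius F"
    unfolding fps_conv_radius_def by (rule conv_radius_geI)
  then have pos: "fps_conv_radius F > 0"
    by (rule less_le_trans[rotated]) (simp add: zero_ereal_def)
  then have "F = fps_expansion (eval_fps F) 0"
    by (intro fps_expansion_eqI[symmetric]) (simp add: has_fps_expansion_def)
  have cont: "isCont (eval_fps F) 0"
    by (rule continuous_eval_fps) (use pos in \<open>simp add: zero_ereal_def\<close>)
  have near: "\<forall>\<^sub>F x in at 0. eval_fps F x = 0"
    unfolding eventually_at
    by (rule exI[of _ 1]) (use F in \<open>auto simp: eval_fps_def sums_iff\<close>)
  have "eval_fps F 0 = 0"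
  proof (rule tendsto_unique[OF trivial_limit_at])
    show "(eval_fps F \<longlongrightarrow> eval_fps F 0) (at 0)" using cont by (simp add: isCont_def)
    show "(eval_fps F \<longlongrightarrow> 0) (at 0)" by (rule tendsto_eventually[OF near])
  qed
  with near have "\<forall>\<^sub>F x in nhds 0. eval_fps F x = 0"
    by (auto simp: eventually_nhds_conv_at)
  then have "eval_fps F has_fps_expansion 0"
    by (simp add: has_fps_expansion_0_iff)
  moreover have "eval_fps F has_fps_expansion F"
    using pos by (simp add: has_fps_expansion_def)
  ultimately have "F = 0"
    by (rule fps_expansion_unique_complex[rotated])
  then show ?thesis
    by (auto simp: F_def fps_eq_iff)
qed

lemma ex_nome:
  fixes x :: complex
  assumes "0 < norm x" "norm x < 1" "N > 0"
  obtains \<tau> where "\<tau> \<in> upper_half_plane" "exp (2 * of_real pi * \<i> * \<tau> / of_nat N) = x"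
proof
  define \<tau> where "\<tau> = of_nat N * Ln x / (2 * of_real pi * \<i>)"
  have "x \<noteq> 0" using assms by auto
  then show "exp (2 * of_real pi * \<i> * \<tau> / of_nat N) = x"
    using assms by (simp add: \<tau>_def)
  define c where "c = real N / (2 * pi)"
  have "\<tau> = of_real c * (- \<i> * Ln x)"
    by (simp add: \<tau>_def c_def field_simps)
  moreover have "Im (- \<i> * Ln x) > 0" and "c > 0"
    using assms \<open>x \<noteq> 0\<close> by (auto simp: c_def ln_less_zero_iff)
  ultimately show "\<tau> \<in> upper_half_plane"
    by (simp add: upper_half_plane_def mult_pos_neg)
qed

lemma norm_nome_less_1:
  assumes "\<tau> \<in> upper_half_plane" "N > 0"
  shows "norm (exp (2 * of_real pi * \<i> * \<tau> / of_nat N)) < 1"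
  using assms by (simp add: upper_half_plane_def)

lemma exp_nome_power:
  "exp (2 * of_real pi * \<i> * of_nat n * \<tau> / of_nat N) = exp (2 * of_real pi * \<i> * \<tau> / of_nat N) ^ n"
  by (simp add: exp_of_nat_mult[symmetric] mult_ac)

lemma fourier_coeff_eq:
  assumes "N > 0"
    and "\<And>\<tau>. \<tau> \<in> upper_half_plane \<Longrightarrow>
      (\<lambda>n. a n * exp (2 * of_real pi * \<i> * of_nat n * \<tau> / of_nat N)) sums f \<tau>"
  shows "fourier_coeff N f = a"
  unfolding fourier_coeff_def
proof (rule the_equality)
  show "\<forall>\<tau>\<in>upper_half_plane. (\<lambda>n. a n * exp (2 * of_real pi * \<i> * of_nat n * \<tau> / of_nat N)) sums f \<tau>"
    using assms by blast
next
  fix b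
  assume b: "\<forall>\<tau>\<in>upper_half_plane. (\<lambda>n. b n * exp (2 * of_real pi * \<i> * of_nat n * \<tau> / of_nat N)) sums f \<tau>"
  show "b = a"
  proof (rule power_series_unique)
    fix x :: complex assume "0 < norm x" "norm x < 1"
    then obtain \<tau> where \<tau>: "\<tau> \<in> upper_half_plane" "exp (2 * of_real pi * \<i> * \<tau> / of_nat N) = x"
      using assms(1) by (rule ex_nome)
    show "(\<lambda>n. a n * x ^ n) sums (\<Sum>n. a n * x ^ n)"
      using assms(2)[OF \<tau>(1)] unfolding exp_nome_power \<tau>(2) by (simp add: sums_iff)
    show "(\<lambda>n. b n * x ^ n) sums (\<Sum>n. a n * x ^ n)"
      using assms(2)[OF \<tau>(1)] b \<tau>(1) unfolding exp_nome_power \<tau>(2) by (metis \<tau>(2) exp_nome_power sums_unique)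
  qed
qed


section \<open>The coefficients of \<open>\<bbbK>\<^sub>2(r, s)\<close>\<close>

definition K2_log :: "rat \<Rightarrow> rat \<Rightarrow> complex \<Rightarrow> complex" where
  "K2_log r s x =
     of_rat (16 * s - 8 * r - 12) * log_euler x - of_rat (24 * s - 30) * log_euler (x ^ 2) +
     of_rat (8 * r + 8 * s - 12) * log_euler (x ^ 4)"

text \<open>
  The coefficient of \<open>x\<^sup>n\<close> in \<open>K2_log r s\<close>, multiplied by \<open>n\<close>.
\<close>
definition K2_log_weight :: "rat \<Rightarrow> rat \<Rightarrow> nat \<Rightarrow> rat" where
  "K2_log_weight r s n =
     (if 2 dvd n then 2 * (24 * s - 30) * of_nat (divisor_sum (n div 2)) else 0) -
     (16 * s - 8 * r - 12) * of_nat (divisor_sum n) -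
     (if 4 dvd n then 4 * (8 * r + 8 * s - 12) * of_nat (divisor_sum (n div 4)) else 0)"

text \<open>
  These are the coefficients of \<open>\<bbbK>\<^sub>2(r, s) / e\<^sup>\<pi>\<^sup>i\<^sup>r\<^sup>\<tau>\<close> in powers of \<open>x = e\<^sup>\<pi>\<^sup>i\<^sup>\<tau>\<close>.
\<close>
definition K2_coeff :: "rat \<Rightarrow> rat \<Rightarrow> nat \<Rightarrow> rat" where
  "K2_coeff r s = exp_coeff (K2_log_weight r s)"

lemma K2_log_sums:
  assumes "norm x < 1"
  shows "(\<lambda>n. of_rat (K2_log_weight r s n) / of_nat n * x ^ n) sums K2_log r s x"
proof -
  have pow: "(\<lambda>n. if k dvd n then - of_nat (k * divisor_sum (n div k)) / of_nat n * x ^ n else 0)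
      sums log_euler (x ^ k)" if "k > 0" for k
  proof -
    have "norm (x ^ k) < 1" using assms that by (simp add: norm_power power_less_one_iff)
    from log_euler_sums[OF this] show ?thesis
      using that by (subst sums_multiples_iff) (simp_all add: power_mult)
  qed
  define A B C where "A = 16 * s - 8 * r - 12" and "B = 24 * s - 30" and "C = 8 * r + 8 * s - 12"
  have "(\<lambda>n. of_rat A * (- of_nat (divisor_sum n) / of_nat n * x ^ n)
      - of_rat B * (if 2 dvd n then - of_nat (2 * divisor_sum (n div 2)) / of_nat n * x ^ n else 0)
      + of_rat C * (if 4 dvd n then - of_nat (4 * divisor_sum (n div 4)) / of_nat n * x ^ n else 0))
    sums K2_log r s x"
    unfolding K2_log_def A_def B_def C_def using assms
    by (intro sums_add sums_diff sums_mult pow log_euler_sums) auto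
  moreover have "of_rat A * (- of_nat (divisor_sum n) / of_nat n * x ^ n)
      - of_rat B * (if 2 dvd n then - of_nat (2 * divisor_sum (n div 2)) / of_nat n * x ^ n else 0)
      + of_rat C * (if 4 dvd n then - of_nat (4 * divisor_sum (n div 4)) / of_nat n * x ^ n else 0)
      = of_rat (K2_log_weight r s n) / of_nat n * x ^ n" for n
    unfolding K2_log_weight_def A_def[symmetric] B_def[symmetric] C_def[symmetric]
    by (cases "2 dvd n"; cases "4 dvd n")
       (simp_all add: of_rat_mult of_rat_add of_rat_diff of_rat_minus divide_inverse algebra_simps)
  ultimately show ?thesis by simp
qed

lemma K2_log_minus:
  assumes "norm x < 1"
  shows "K2_log r s (- x) = K2_log r (r - s + 3 / 2) x"
  using assms
  by (simp add: K2_log_def log_euler_minus of_rat_mult of_rat_add of_rat_diff of_rat_divide algebra_simps)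

lemma K2_coeff_sums:
  assumes "norm x < 1"
  shows "(\<lambda>n. of_rat (K2_coeff r s n) * x ^ n) sums exp (K2_log r s x)"
  unfolding K2_coeff_def using assms by (intro exp_power_series K2_log_sums)

lemma K2_coeff_0 [simp]: "K2_coeff r s 0 = 1"
  by (simp add: K2_coeff_def)

text \<open>
  The substitution \<open>x \<mapsto> -x\<close>, that is \<open>\<tau> \<mapsto> \<tau> + 1\<close>, turns the exponential for \<open>(r, s)\<close> into the one
  for the reflected pair.
\<close>
theorem K2_coeff_reflect: "K2_coeff r (r - s + 3 / 2) n = (- 1) ^ n * K2_coeff r s n"
proof -
  have "(\<lambda>n. of_rat (K2_coeff r (r - s + 3 / 2) n)) = (\<lambda>n. of_rat (K2_coeff r s n) * (- 1) ^ n :: complex)"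
  proof (rule power_series_unique[where f = "\<lambda>x. exp (K2_log r (r - s + 3 / 2) x)"])
    fix x :: complex assume x: "norm x < 1"
    then show "(\<lambda>n. of_rat (K2_coeff r (r - s + 3 / 2) n) * x ^ n) sums exp (K2_log r (r - s + 3 / 2) x)"
      by (rule K2_coeff_sums)
    show "(\<lambda>n. of_rat (K2_coeff r s n) * (- 1) ^ n * x ^ n) sums exp (K2_log r (r - s + 3 / 2) x)"
      using K2_coeff_sums[of "- x" r s] x
      by (simp only: K2_log_minus power_minus[of x] mult.assoc norm_minus_cancel)
  qed
  from fun_cong[OF this, of n]
  have "of_rat (K2_coeff r (r - s + 3 / 2) n) = (of_rat ((- 1) ^ n * K2_coeff r s n) :: complex)"
    by (simp add: of_rat_mult of_rat_power of_rat_minus)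
  then show ?thesis by (simp only: of_rat_eq_iff)
qed

lemma eta_powr_eq_exp:
  assumes "\<tau> \<in> upper_half_plane"
  shows "eta_powr y \<tau> =
    exp (2 * of_real pi * \<i> * of_rat y * \<tau> / 24 + of_rat y * log_euler (exp (2 * of_real pi * \<i> * \<tau>)))"
proof -
  define q where "q = exp (2 * of_real pi * \<i> * \<tau>)"
  have q: "norm q < 1" using norm_nome_less_1[OF assms, of 1] by (simp add: q_def)
  have e: "exp (2 * of_real pi * \<i> * of_nat (n + 1) * \<tau>) = q ^ (n + 1)" for n
    using exp_nome_power[of "n + 1" \<tau> 1] by (simp add: q_def)
  have "(1 - q ^ (n + 1)) powr of_rat y = exp (of_rat y * Ln (1 - q ^ (n + 1)))" for n
  proof -
    have "norm (q ^ (n + 1)) < 1" using q by (simp add: norm_power power_less_one_iff del: power_Suc)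
    then have "1 - q ^ (n + 1) \<noteq> 0" by auto
    then show ?thesis by (simp add: powr_def)
  qed
  then have "(\<Prod>n. (1 - q ^ (n + 1)) powr of_rat y) = (\<Prod>n. exp (of_rat y * Ln (1 - q ^ (n + 1))))"
    by simp
  also have "\<dots> = exp (of_rat y * log_euler q)"
    unfolding log_euler_def using summable_log_euler[OF q]
    by (subst prodinf_exp) (auto intro: summable_mult simp: suminf_mult)
  finally show ?thesis
    unfolding eta_powr_def e by (simp add: exp_add q_def)
qed

lemma K2_eq_exp:
  assumes "\<tau> \<in> upper_half_plane"
  shows "K2 r s \<tau> = exp (of_real pi * \<i> * of_rat r * \<tau>) * exp (K2_log r s (exp (of_real pi * \<i> * \<tau>)))"
proof -
  define x where "x = exp (of_real pi * \<i> * \<tau>)"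
  have pow: "exp (2 * of_real pi * \<i> * \<tau>) = x ^ 2" "exp (2 * of_real pi * \<i> * (2 * \<tau>)) = x ^ 4"
    "exp (2 * of_real pi * \<i> * (\<tau> / 2)) = x"
    by (simp_all add: x_def exp_of_nat_mult[symmetric] mult_ac)
  have "\<tau> / 2 \<in> upper_half_plane" "2 * \<tau> \<in> upper_half_plane"
    using assms by (auto simp: upper_half_plane_def)
  then have "K2 r s \<tau> = exp (2 * of_real pi * \<i> * of_rat (16 * s - 8 * r - 12) * (\<tau> / 2) / 24 +
        2 * of_real pi * \<i> * of_rat (8 * r + 8 * s - 12) * (2 * \<tau>) / 24 -
        2 * of_real pi * \<i> * of_rat (24 * s - 30) * \<tau> / 24) * exp (K2_log r s x)"
    using assms
    by (simp only: K2_def eta_powr_eq_exp pow K2_log_def exp_add exp_diff)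
       (simp only: divide_inverse inverse_mult_distrib inverse_inverse_eq mult_ac)
  also have "2 * of_real pi * \<i> * of_rat (16 * s - 8 * r - 12) * (\<tau> / 2) / 24 +
        2 * of_real pi * \<i> * of_rat (8 * r + 8 * s - 12) * (2 * \<tau>) / 24 -
        2 * of_real pi * \<i> * of_rat (24 * s - 30) * \<tau> / 24 = of_real pi * \<i> * of_rat r * \<tau>"
    by (simp add: of_rat_mult of_rat_add of_rat_diff field_simps)
  finally show ?thesis by (simp add: x_def)
qed

lemma rat_denom_of_nat_divide:
  assumes "b > 0" "coprime a b"
  shows "rat_denom (of_nat a / of_nat b) = b"
proof -
  have "(of_nat a / of_nat b :: rat) = Rat.Fract (int a) (int b)"
    by (simp add: Fract_of_int_quotient)
  then show ?thesis
    using assms by (simp add: rat_denom_def quotient_of_Fract normalize_stable)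
qed

lemma positive_rat_lowest_terms:
  fixes r :: rat
  assumes "r > 0"
  obtains a where "a > 0" "coprime a (rat_denom r)" "r = of_nat a / of_nat (rat_denom r)" "rat_denom r > 0"
proof -
  obtain p q where pq: "quotient_of r = (p, q)" by force
  have q: "q > 0" and "coprime p q" and r: "r = of_int p / of_int q"
    using quotient_of_denom_pos[OF pq] quotient_of_coprime[OF pq] quotient_of_div[OF pq] by auto
  have "p > 0" using assms q unfolding r by (simp add: zero_less_divide_iff)
  have d: "rat_denom r = nat q" by (simp add: rat_denom_def pq)
  show ?thesis
  proof
    show "nat p > 0" using \<open>p > 0\<close> by simp
    show "coprime (nat p) (rat_denom r)"
      using \<open>coprime p q\<close> \<open>p > 0\<close> q by (simp add: d flip: coprime_int_iff)
    show "r = of_nat (nat p) / of_nat (rat_denom r)"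
      unfolding d using q \<open>p > 0\<close> by (subst r) (simp add: of_nat_nat)
    show "rat_denom r > 0" using q by (simp add: d)
  qed
qed

text \<open>
  With \<open>N = 2b\<close> and \<open>q = e\<^bsup>2\<pi>i\<tau>/N\<^esup>\<close> one has \<open>e\<^bsup>\<pi>i(a/b)\<tau>\<^esup> = q\<^sup>a\<close> and \<open>x = q\<^sup>b\<close>. So the exponents
  that occur are \<open>a + k b\<close>.
\<close>
definition K2_fourier :: "nat \<Rightarrow> nat \<Rightarrow> rat \<Rightarrow> nat \<Rightarrow> rat" where
  "K2_fourier a b s n =
     (if a \<le> n \<and> b dvd n - a then K2_coeff (of_nat a / of_nat b) s ((n - a) div b) else 0)"

lemma K2_fourier_sums:
  assumes "b > 0" and "\<tau> \<in> upper_half_plane"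
  shows "(\<lambda>n. of_rat (K2_fourier a b s n) * exp (2 * of_real pi * \<i> * of_nat n * \<tau> / of_nat (2 * b)))
    sums K2 (of_nat a / of_nat b) s \<tau>"
proof -
  define q where "q = exp (2 * of_real pi * \<i> * \<tau> / of_nat (2 * b))"
  define x where "x = exp (of_real pi * \<i> * \<tau>)"
  have x: "norm x < 1"
    using norm_nome_less_1[OF assms(2), of 2] by (simp add: x_def)
  have qb: "q ^ b = x" and qa: "q ^ a = exp (of_real pi * \<i> * of_rat (of_nat a / of_nat b) * \<tau>)"
    using assms(1) by (simp_all add: q_def x_def exp_of_nat_mult[symmetric] of_rat_divide field_simps)
  have "(\<lambda>k. q ^ a * (of_rat (K2_coeff (of_nat a / of_nat b) s k) * x ^ k))
      sums K2 (of_nat a / of_nat b) s \<tau>"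
    unfolding K2_eq_exp[OF assms(2)] x_def[symmetric] qa[symmetric]
    by (intro sums_mult K2_coeff_sums x)
  moreover have "q ^ a * (of_rat (K2_coeff (of_nat a / of_nat b) s k) * x ^ k) =
      of_rat (K2_fourier a b s (a + k * b)) * q ^ (a + k * b)" for k
    using assms(1) by (simp add: K2_fourier_def qb[symmetric] power_add power_mult[symmetric] mult.commute[of b])
  ultimately have "(\<lambda>k. of_rat (K2_fourier a b s (a + k * b)) * q ^ (a + k * b)) sums K2 (of_nat a / of_nat b) s \<tau>"
    by simp
  then have "(\<lambda>n. of_rat (K2_fourier a b s n) * q ^ n) sums K2 (of_nat a / of_nat b) s \<tau>"
  proof (subst (asm) sums_mono_reindex[where g = "\<lambda>k. a + k * b" and f = "\<lambda>n. of_rat (K2_fourier a b s n) * q ^ n"])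
    show "strict_mono (\<lambda>k. a + k * b)" using assms(1) by (simp add: strict_mono_def)
  next
    fix n assume n: "n \<notin> range (\<lambda>k. a + k * b)"
    have "\<not> (a \<le> n \<and> b dvd n - a)"
    proof
      assume *: "a \<le> n \<and> b dvd n - a"
      then obtain k where "n = a + k * b"
        by (metis dvd_def le_add_diff_inverse mult.commute)
      with n show False by blast
    qed
    then show "of_rat (K2_fourier a b s n) * q ^ n = 0" by (auto simp: K2_fourier_def)
  qed
  then show ?thesis
    unfolding q_def exp_nome_power .
qed

lemma K2_fourier_reflect:
  "K2_fourier a b (of_nat a / of_nat b - s + 3 / 2) n = (- 1) ^ ((n - a) div b) * K2_fourier a b s n"
  by (simp add: K2_fourier_def K2_coeff_reflect)

theorem fourier_coeff_K2_reflect: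
  assumes "r > 0"
  shows "fourier_coeff (K2_width r) (K2 r s) n = fourier_coeff (K2_width r) (K2 r (r - s + 3 / 2)) n \<or>
         fourier_coeff (K2_width r) (K2 r s) n = - fourier_coeff (K2_width r) (K2 r (r - s + 3 / 2)) n"
proof -
  obtain a where a: "coprime a (rat_denom r)" "r = of_nat a / of_nat (rat_denom r)" "rat_denom r > 0"
    using positive_rat_lowest_terms[OF assms] by metis
  define b where "b = rat_denom r"
  have b: "b > 0" "r = of_nat a / of_nat b" "K2_width r = 2 * b"
    using a by (simp_all add: b_def K2_width_def)
  have "fourier_coeff (K2_width r) (K2 r t) = (\<lambda>n. of_rat (K2_fourier a b t n))" for t
    unfolding b(3) unfolding b(2) using b(1) by (intro fourier_coeff_eq K2_fourier_sums) auto
  then show ?thesis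
    using K2_fourier_reflect[of a b s n] b(2)
    by (cases "even ((n - a) div b)") (simp_all add: of_rat_minus)
qed

section \<open>Hecke operators on q-expansions\<close>

definition q_expansion :: "(complex \<Rightarrow> complex) \<Rightarrow> (nat \<Rightarrow> complex) \<Rightarrow> bool" where
  "q_expansion f a \<longleftrightarrow>
     (\<forall>\<tau>\<in>upper_half_plane. (\<lambda>n. a n * exp (2 * of_real pi * \<i> * of_nat n * \<tau>)) sums f \<tau>)"

lemma q_expansionD:
  "q_expansion f a \<Longrightarrow> \<tau> \<in> upper_half_plane \<Longrightarrow>
    (\<lambda>n. a n * exp (2 * of_real pi * \<i> * of_nat n * \<tau>)) sums f \<tau>"
  by (simp add: q_expansion_def)

lemma fourier_coeff_q_expansion:
  assumes "q_expansion f a"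
  shows "fourier_coeff 1 f = a"
  using assms by (intro fourier_coeff_eq) (simp_all add: q_expansion_def)

lemma q_expansion_unique:
  assumes "q_expansion f a" "q_expansion g b" "\<And>\<tau>. \<tau> \<in> upper_half_plane \<Longrightarrow> f \<tau> = g \<tau>"
  shows "a = b"
  using assms fourier_coeff_q_expansion[of f a] fourier_coeff_q_expansion[of f b]
  by (simp add: q_expansion_def)

lemma twist_eq:
  assumes "q_expansion f a" "q_expansion g b" "\<And>n. a n = chi (int n) * b n" "\<tau> \<in> upper_half_plane"
  shows "f \<tau> = twist chi g \<tau>"
  using q_expansionD[OF assms(1,4)] assms(3) fourier_coeff_q_expansion[OF assms(2)]
  by (simp add: twist_def sums_iff)

lemma q_expansion_K2_normalized:
  assumes "b > 0" "coprime a b"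
  shows "q_expansion (K2_normalized (of_nat a / of_nat b) s) (\<lambda>n. of_rat (K2_fourier a b s n))"
  unfolding q_expansion_def
proof
  fix \<tau> :: complex assume "\<tau> \<in> upper_half_plane"
  then have "of_nat (2 * b) * \<tau> \<in> upper_half_plane"
    using assms by (simp add: upper_half_plane_def)
  from K2_fourier_sums[OF assms(1) this, of a s]
  show "(\<lambda>n. of_rat (K2_fourier a b s n) * exp (2 * of_real pi * \<i> * of_nat n * \<tau>))
      sums K2_normalized (of_nat a / of_nat b) s \<tau>"
    using assms
    by (simp add: K2_normalized_def K2_width_def rat_denom_of_nat_divide mult_ac)
qed

lemma sum_roots_of_unity:
  assumes "p > 0"
  shows "(\<Sum>j<p. exp (2 * of_real pi * \<i> * of_nat n / of_nat p) ^ j) = (if p dvd n then of_nat p else (0 :: complex))"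
proof -
  define z where "z = exp (2 * of_real pi * \<i> * of_nat n / of_nat p)"
  have "z = 1 \<longleftrightarrow> p dvd n"
    unfolding z_def using assms by (intro complex_root_unity_eq_1) auto
  moreover have "z ^ p = 1"
    unfolding z_def using assms by (auto simp: exp_of_nat_mult[symmetric] exp_eq_1 intro!: exI[of _ "int n"])
  ultimately show ?thesis
    using assms by (auto simp: z_def[symmetric] geometric_sum sum.If_cases)
qed

text \<open>
  Averaging over the translates \<open>(\<tau> + j)/p\<close> kills the exponents not divisible by \<open>p\<close>, by
  \<open>sum_roots_of_unity\<close>.
\<close>
lemma q_expansion_hecke_op:
  assumes f: "q_expansion f a" and p: "p > 0"
  shows "q_expansion (hecke_op k eps p f)
    (\<lambda>n. a (p * n) + eps (int p) * of_nat p ^ (k - 1) * (if p dvd n then a (n div p) else 0))"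
  unfolding q_expansion_def
proof
  fix \<tau> :: complex assume \<tau>: "\<tau> \<in> upper_half_plane"
  define e where "e = (\<lambda>n. exp (2 * of_real pi * \<i> * of_nat n * \<tau>))"
  define e' where "e' = (\<lambda>n. exp (2 * of_real pi * \<i> * of_nat n * \<tau> / of_nat p))"
  have "(\<lambda>n. (\<Sum>j<p. a n * exp (2 * of_real pi * \<i> * of_nat n * ((\<tau> + of_nat j) / of_nat p))) / of_nat p)
      sums ((\<Sum>j<p. f ((\<tau> + of_nat j) / of_nat p)) / of_nat p)"
    using p \<tau> by (intro sums_divide sums_sum q_expansionD[OF f]) (simp add: upper_half_plane_def)
  moreover have "(\<Sum>j<p. a n * exp (2 * of_real pi * \<i> * of_nat n * ((\<tau> + of_nat j) / of_nat p))) / of_nat p =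
      (if p dvd n then a n * e' n else 0)" for n
  proof -
    have "exp (2 * of_real pi * \<i> * of_nat n * ((\<tau> + of_nat j) / of_nat p)) =
        e' n * exp (2 * of_real pi * \<i> * of_nat n / of_nat p) ^ j" for j
      by (simp add: e'_def exp_add[symmetric] exp_of_nat_mult[symmetric] add_divide_distrib algebra_simps)
    then show ?thesis
      using p by (simp add: sum_distrib_left[symmetric] mult.assoc[symmetric] sum_roots_of_unity)
  qed
  ultimately have "(\<lambda>n. if p dvd n then a n * e' n else 0)
      sums ((\<Sum>j<p. f ((\<tau> + of_nat j) / of_nat p)) / of_nat p)"
    by simp
  moreover have "e' (p * n) = e n" for n using p by (simp add: e_def e'_def field_simps)
  ultimately have 1: "(\<lambda>n. a (p * n) * e n) sums ((\<Sum>j<p. f ((\<tau> + of_nat j) / of_nat p)) / of_nat p)"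
    using sums_multiples_iff[OF p, of "\<lambda>n. a n * e' n"] by simp
  have "of_nat p * \<tau> \<in> upper_half_plane" using \<tau> p by (simp add: upper_half_plane_def)
  from q_expansionD[OF f this] have "(\<lambda>n. a n * e (p * n)) sums f (of_nat p * \<tau>)"
    by (simp add: e_def mult_ac)
  then have 2: "(\<lambda>n. if p dvd n then a (n div p) * e n else 0) sums f (of_nat p * \<tau>)"
    using sums_multiples_iff[OF p, of "\<lambda>n. a (n div p) * e n"] p by simp
  have "(\<lambda>n. a (p * n) * e n + eps (int p) * of_nat p ^ (k - 1) * (if p dvd n then a (n div p) * e n else 0))
      sums hecke_op k eps p f \<tau>"
    unfolding hecke_op_def by (intro sums_add sums_mult 1 2)
  then show "(\<lambda>n. (a (p * n) + eps (int p) * of_nat p ^ (k - 1) * (if p dvd n then a (n div p) else 0)) *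
      exp (2 * of_real pi * \<i> * of_nat n * \<tau>)) sums hecke_op k eps p f \<tau>"
    by (rule sums_cong[THEN iffD1, rotated]) (simp add: e_def algebra_simps)
qed

text \<open>
  The eigenvalue is the coefficient of \<open>q\<^sup>p\<close>, as comparison at \<open>n = 1\<close> shows. The character of the
  form enters only at exponents divisible by \<open>p\<close>.
\<close>
lemma hecke_eigenform_coeff_mult:
  assumes f: "q_expansion f a" "hecke_eigenform_away_from_6 k f" and a1: "a 1 = 1"
    and p: "prime p" "coprime p 6" "\<not> p dvd n"
  shows "a (p * n) = a p * a n"
proof -
  obtain eps c where c: "\<And>\<tau>. \<tau> \<in> upper_half_plane \<Longrightarrow> hecke_op k eps p f \<tau> = c * f \<tau>"
    using f(2) p unfolding hecke_eigenform_away_from_6_def by metis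
  have "q_expansion (\<lambda>\<tau>. c * f \<tau>) (\<lambda>n. c * a n)"
    using f(1) by (auto simp: q_expansion_def mult.assoc intro!: sums_mult)
  from q_expansion_unique[OF q_expansion_hecke_op[OF f(1) prime_gt_0_nat[OF p(1)]] this c]
  have "a (p * n) + eps (int p) * of_nat p ^ (k - 1) * (if p dvd n then a (n div p) else 0) = c * a n" for n
    by (rule fun_cong)
  from this[of 1] this[of n] show ?thesis
    using p a1 not_prime_1 by (auto split: if_splits)
qed


section \<open>Conjugate families on the lattice of 24ths\<close>

text \<open>
  The elements of \<open>S2'\<close> are the pairs \<open>(i/24, j/24)\<close> with \<open>(i, j)\<close> in this set:
  \<open>24 r = 3 (8 (r + s)) - 24 s\<close> is an integer.
\<close>
definition grid :: "(int \<times> int) set" where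
  "grid = {(i, j). 0 < i \<and> i < j \<and> j < 36 \<and> 3 dvd i + j}"

definition grid_pair :: "int \<times> int \<Rightarrow> rat \<times> rat" where
  "grid_pair = (\<lambda>(i, j). (of_int i / 24, of_int j / 24))"

lemma of_int_divide_Ints_iff:
  assumes "m \<noteq> 0"
  shows "(of_int k / of_int m :: rat) \<in> \<int> \<longleftrightarrow> m dvd k"
proof
  assume "(of_int k / of_int m :: rat) \<in> \<int>"
  then obtain l where "(of_int k / of_int m :: rat) = of_int l" by (auto elim: Ints_cases)
  then have "(of_int k :: rat) = of_int (m * l)" using assms by (simp add: field_simps)
  then show "m dvd k" by (simp only: of_int_eq_iff) simp
qed (use assms in auto)

lemma S2'_eq_grid: "S2' = grid_pair ` grid"
proof (intro equalityI subsetI)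
  fix p assume p: "p \<in> S2'"
  obtain r s where rs: "p = (r, s)" by force
  have S: "0 < r" "r < s" "s < 3 / 2" "24 * s \<in> \<int>" "8 * (r + s) \<in> \<int>"
    using p by (auto simp: rs S2'_def)
  obtain j l where j: "24 * s = of_int j" and l: "8 * (r + s) = of_int l"
    using S(4,5) by (auto elim!: Ints_cases)
  define i where "i = 3 * l - j"
  have i: "24 * r = of_int i" using j l by (simp add: i_def)
  have "(of_int 0 :: rat) < of_int i" "(of_int i :: rat) < of_int j" "(of_int j :: rat) < of_int 36"
    using S i j by linarith+
  then have "(i, j) \<in> grid" unfolding of_int_less_iff by (simp add: grid_def i_def)
  moreover have "p = grid_pair (i, j)" using i j by (simp add: rs grid_pair_def field_simps)
  ultimately show "p \<in> grid_pair ` grid" by blast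
next
  fix p assume "p \<in> grid_pair ` grid"
  then obtain i j where p: "p = grid_pair (i, j)" and ij: "0 < i" "i < j" "j < 36" "3 dvd i + j"
    by (auto simp: grid_def)
  obtain l where l: "i + j = 3 * l" using ij(4) by (elim dvdE)
  have "8 * (of_int i / 24 + of_int j / 24) = (of_int (i + j) / 3 :: rat)" by simp
  also have "\<dots> = of_int l" by (simp only: l of_int_mult)
  finally have "8 * (of_int i / 24 + of_int j / 24) \<in> (\<int> :: rat set)" by simp
  moreover have "of_int j / 24 < (3 / 2 :: rat)"
    using ij(3) of_int_less_iff[of j 36, where ?'a = rat] by simp
  ultimately show "p \<in> S2'"
    using ij by (simp add: p grid_pair_def S2'_def divide_strict_right_mono)
qed

lemma rat_denom_dvd_iff: "int (rat_denom r) dvd m \<longleftrightarrow> of_int m * r \<in> \<int>"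
proof -
  obtain p q where pq: "quotient_of r = (p, q)" by force
  have q: "q > 0" and cop: "coprime p q" and r: "r = of_int p / of_int q"
    using quotient_of_denom_pos[OF pq] quotient_of_coprime[OF pq] quotient_of_div[OF pq] by auto
  have "of_int m * r \<in> \<int> \<longleftrightarrow> q dvd m * p"
    using of_int_divide_Ints_iff[of q "m * p"] q by (simp add: r)
  also have "\<dots> \<longleftrightarrow> q dvd m"
    using cop by (simp add: coprime_dvd_mult_left_iff coprime_commute)
  finally show ?thesis using q by (simp add: rat_denom_def pq)
qed

lemma pair_denom_dvd_iff:
  "int (pair_denom p) dvd m \<longleftrightarrow> even m \<and> of_int m * fst p \<in> \<int> \<and> of_int m * snd p \<in> \<int>"
proof -
  have "int (pair_denom p) = lcm (int 2) (lcm (int (rat_denom (fst p))) (int (rat_denom (snd p))))"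
    by (simp only: pair_denom_def lcm_int_int_eq)
  then show ?thesis by (simp only: lcm_least_iff rat_denom_dvd_iff) simp
qed

text \<open>
  Conjugacy with multipliers coprime to 24 instead of the common denominators. Units modulo a
  divisor of 24 lift to units modulo 24, so this is the same relation on \<open>S2'\<close>, and it is visibly
  an equivalence relation.
\<close>
definition conj_grid :: "int \<times> int \<Rightarrow> int \<times> int \<Rightarrow> bool" where
  "conj_grid = (\<lambda>(i, j) (i', j'). \<exists>c. coprime c 24 \<and> 24 dvd i - c * i' \<and> 24 dvd j - c * j')"

lemma coprime_24_iff: "coprime c (24 :: int) \<longleftrightarrow> odd c \<and> \<not> 3 dvd c"
proof -
  have "coprime c (2 ^ 3 * 3 :: int) \<longleftrightarrow> odd c \<and> \<not> 3 dvd c"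
    unfolding coprime_mult_right_iff coprime_power_right_iff
    using prime_imp_coprime[of 3 c] by (auto simp: coprime_commute)
  then show ?thesis by simp
qed

lemma pair_denom_dvd_24: "int (pair_denom (grid_pair p)) dvd 24"
  by (cases p) (simp add: pair_denom_dvd_iff grid_pair_def)

text \<open>
  The common denominator \<open>M\<close> is even and divides 24, so a multiplier coprime to \<open>M\<close> is odd. If it
  is divisible by 3, then \<open>M\<close> is not, and adding \<open>M\<close> to it makes it coprime to 24 without changing
  its effect.
\<close>
lemma conjugate_grid_pair_iff: "conjugate_pairs (grid_pair p) (grid_pair p') \<longleftrightarrow> conj_grid p p'"
proof -
  obtain i j i' j' where p: "p = (i, j)" and p': "p' = (i', j')" by force
  define M where "M = int (pair_denom (grid_pair p'))"
  have diff: "of_int i / 24 - of_int c * of_int i' / 24 \<in> (\<int> :: rat set) \<longleftrightarrow> 24 dvd i - c * i'" for i i' c :: int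
    using of_int_divide_Ints_iff[of 24 "i - c * i'"] by (simp add: diff_divide_distrib)
  have conj: "conjugate_pairs (grid_pair p) (grid_pair p') \<longleftrightarrow>
    (\<exists>c. coprime c (int (pair_denom (grid_pair p))) \<and> coprime c M \<and> 24 dvd i - c * i' \<and> 24 dvd j - c * j')"
    by (simp add: conjugate_pairs_def M_def p p' grid_pair_def diff)
  show ?thesis
  proof
    assume "conj_grid p p'"
    then show "conjugate_pairs (grid_pair p) (grid_pair p')"
      unfolding conj using coprime_divisors[OF dvd_refl pair_denom_dvd_24]
      by (auto simp: conj_grid_def p p' M_def)
  next
    assume "conjugate_pairs (grid_pair p) (grid_pair p')"
    then obtain c where c: "coprime c M" "24 dvd i - c * i'" "24 dvd j - c * j'"
      unfolding conj by blast
    have M: "even M" "24 dvd M * i'" "24 dvd M * j'"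
      using pair_denom_dvd_iff[of "grid_pair p'" M] of_int_divide_Ints_iff[of 24 "M * i'"]
        of_int_divide_Ints_iff[of 24 "M * j'"]
      by (simp_all add: M_def p' grid_pair_def)
    have "odd c" using coprime_divisors[OF dvd_refl, of 2 M c] c(1) M(1) by simp
    show "conj_grid p p'"
    proof (cases "3 dvd c")
      case False
      then show ?thesis
        using c \<open>odd c\<close> by (auto simp: conj_grid_def p p' coprime_24_iff)
    next
      case True
      then have "\<not> 3 dvd M" using c(1) by (auto dest: coprime_common_divisor)
      then have "coprime (c + M) 24"
        using True \<open>odd c\<close> M(1) by (simp add: coprime_24_iff dvd_add_right_iff)
      moreover have "24 dvd i - (c + M) * i'" "24 dvd j - (c + M) * j'"
        using dvd_diff[OF c(2) M(2)] dvd_diff[OF c(3) M(3)] by (simp_all add: algebra_simps)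
      ultimately show ?thesis by (auto simp: conj_grid_def p p')
    qed
  qed
qed

text \<open>
  Every unit modulo 24 is its own inverse; this makes the relation symmetric.
\<close>
lemma coprime_24_square:
  assumes "coprime c (24 :: int)"
  shows "24 dvd c * c - 1"
proof -
  have "c mod 24 \<in> {0..<24}" by simp
  moreover have "{0..<24} = set [0..23 :: int]" by auto
  moreover have "coprime (c mod 24) 24" using assms by (simp add: coprime_commute)
  ultimately have "c mod 24 \<in> {1, 5, 7, 11, 13, 17, 19, 23}"
    unfolding coprime_24_iff by (auto simp: upto.simps)
  then have "(c mod 24) * (c mod 24) mod 24 = 1" by auto
  then have "c * c mod 24 = 1 mod 24" by (simp add: mod_mult_eq)
  then show ?thesis by (simp only: mod_eq_dvd_iff)
qed

lemma conj_grid_refl: "conj_grid p p"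
  by (auto simp: conj_grid_def intro: exI[of _ 1])

lemma conj_grid_sym: "conj_grid p p' \<Longrightarrow> conj_grid p' p"
proof -
  obtain i j i' j' where p: "p = (i, j)" "p' = (i', j')" by force
  assume "conj_grid p p'"
  then obtain c where c: "coprime c 24" "24 dvd i - c * i'" "24 dvd j - c * j'"
    by (auto simp: conj_grid_def p)
  have "24 dvd x' - c * x" if "24 dvd x - c * x'" for x x'
  proof -
    have "x' - c * x = - (c * (x - c * x') + (c * c - 1) * x')" by (simp add: algebra_simps)
    then show ?thesis using that coprime_24_square[OF c(1)] by simp
  qed
  then show ?thesis using c by (auto simp: conj_grid_def p)
qed

lemma conj_grid_trans: "conj_grid p p' \<Longrightarrow> conj_grid p' p'' \<Longrightarrow> conj_grid p p''"
proof -
  obtain i j i' j' i'' j'' where p: "p = (i, j)" "p' = (i', j')" "p'' = (i'', j'')" by (metis surj_pair)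
  assume "conj_grid p p'" "conj_grid p' p''"
  then obtain c d where c: "coprime c 24" "24 dvd i - c * i'" "24 dvd j - c * j'"
    and d: "coprime d 24" "24 dvd i' - d * i''" "24 dvd j' - d * j''"
    by (auto simp: conj_grid_def p)
  have "24 dvd x - c * d * x''" if "24 dvd x - c * x'" "24 dvd x' - d * x''" for x x' x''
    using dvd_add[OF that(1) dvd_mult[OF that(2), of c]] by (simp add: algebra_simps)
  then show ?thesis
    using c d by (auto simp: conj_grid_def p intro!: exI[of _ "c * d"])
qed

definition grid_family :: "int \<times> int \<Rightarrow> (int \<times> int) set" where
  "grid_family p = {q \<in> grid. conj_grid p q}"

lemma inj_grid_pair: "inj grid_pair"
  by (auto simp: inj_def grid_pair_def)

lemma conj_family_grid_pair: "conj_family (grid_pair p) = grid_pair ` grid_family p"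
  by (auto simp: conj_family_def grid_family_def S2'_eq_grid conjugate_grid_pair_iff)

lemma grid_family_cong:
  assumes "conj_grid p q"
  shows "grid_family p = grid_family q"
  using assms conj_grid_sym conj_grid_trans unfolding grid_family_def by blast

lemma fst_grid_pair_eq_iff: "fst (grid_pair p) = fst (grid_pair q) \<longleftrightarrow> fst p = fst q"
  by (cases p; cases q) (simp add: grid_pair_def)

text \<open>
  A family may be described from any of its members.
\<close>
lemma galois_family_cases:
  assumes "galois_family F" "p \<in> F"
  obtains q where "q \<in> grid" "p = grid_pair q" "F = grid_pair ` grid_family q" "inj_on fst (grid_family q)"
proof -
  obtain p0 where p0: "p0 \<in> grid" "F = conj_family (grid_pair p0)" "inj_on fst F"
    using assms(1) by (auto simp: galois_family_def S2'_eq_grid)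
  then obtain q where q: "q \<in> grid" "p = grid_pair q" "conj_grid p0 q"
    using assms(2) by (auto simp: conj_family_grid_pair grid_family_def)
  then have F: "F = grid_pair ` grid_family q"
    using grid_family_cong[OF q(3)] by (simp add: p0 conj_family_grid_pair)
  moreover have "inj_on fst (grid_family q)"
    using p0(3) unfolding F inj_on_def by (metis fst_grid_pair_eq_iff imageI inj_grid_pair injD)
  ultimately show ?thesis using that q by blast
qed

lemma galois_familyI:
  assumes "q \<in> grid" "inj_on fst (grid_family q)"
  shows "galois_family (grid_pair ` grid_family q)"
  unfolding galois_family_def
proof (intro conjI bexI)
  show "grid_pair ` grid_family q = conj_family (grid_pair q)" by (simp add: conj_family_grid_pair)
  show "grid_pair q \<in> S2'" using assms by (simp add: S2'_eq_grid)
  show "inj_on fst (grid_pair ` grid_family q)"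
    using assms(2) by (auto simp: inj_on_def fst_grid_pair_eq_iff)
qed

text \<open>
  This is \<open>(r, s) \<mapsto> (r, r - s + 3/2)\<close>. It is an involution of the grid that commutes with
  conjugation, because multipliers are odd and \<open>3/2 (1 - c)\<close> is then an integer.
\<close>
definition reflect :: "int \<times> int \<Rightarrow> int \<times> int" where
  "reflect = (\<lambda>(i, j). (i, i - j + 36))"

lemma fst_reflect [simp]: "fst (reflect p) = fst p"
  by (cases p) (simp add: reflect_def)

lemma reflect_reflect [simp]: "reflect (reflect p) = p"
  by (cases p) (simp add: reflect_def)

lemma grid_pair_reflect: "grid_pair (reflect (i, j)) = (of_int i / 24, of_int i / 24 - of_int j / 24 + 3 / 2)"
  by (simp add: grid_pair_def reflect_def add_divide_distrib diff_divide_distrib)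

lemma reflect_in_grid: "p \<in> grid \<Longrightarrow> reflect p \<in> grid"
  by (cases p) (auto simp: grid_def reflect_def; presburger)

lemma conj_grid_reflect:
  assumes "conj_grid p q"
  shows "conj_grid (reflect p) (reflect q)"
proof -
  obtain i j i' j' where p: "p = (i, j)" "q = (i', j')" by force
  obtain c where c: "coprime c 24" "24 dvd i - c * i'" "24 dvd j - c * j'"
    using assms by (auto simp: conj_grid_def p)
  then obtain k where "c = 2 * k + 1" by (auto simp: coprime_24_iff elim: oddE)
  then have "(i - j + 36) - c * (i' - j' + 36) = (i - c * i') - (j - c * j') - 24 * (3 * k)"
    by (simp add: algebra_simps)
  moreover have "24 dvd (i - c * i') - (j - c * j') - 24 * (3 * k)" using c by (intro dvd_diff[of 24 "_ - _"]) simp_all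
  ultimately have "24 dvd (i - j + 36) - c * (i' - j' + 36)" by (simp only:)
  with c(1,2) have "\<exists>c. coprime c 24 \<and> 24 dvd i - c * i' \<and> 24 dvd (i - j + 36) - c * (i' - j' + 36)"
    by (intro exI[of _ c] conjI)
  then show ?thesis by (simp only: conj_grid_def p reflect_def prod.case)
qed

lemma grid_family_reflect: "grid_family (reflect p) = reflect ` grid_family p"
proof -
  have sub: "reflect ` grid_family p \<subseteq> grid_family (reflect p)" for p
  proof
    fix q assume "q \<in> reflect ` grid_family p"
    then obtain q' where "q = reflect q'" "q' \<in> grid" "conj_grid p q'" by (auto simp: grid_family_def)
    then show "q \<in> grid_family (reflect p)"
      by (simp add: grid_family_def reflect_in_grid conj_grid_reflect)
  qed
  from image_mono[OF sub[of "reflect p"], of reflect] sub[of p] show ?thesis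
    by (simp add: image_image)
qed

lemma inj_on_fst_reflect: "inj_on fst (grid_family (reflect p)) \<longleftrightarrow> inj_on fst (grid_family p)"
proof -
  have "inj_on reflect (grid_family p)" by (metis inj_onI reflect_reflect)
  moreover have "fst \<circ> reflect = fst" by auto
  ultimately show ?thesis
    using comp_inj_on_iff[of reflect "grid_family p" fst] by (simp add: grid_family_reflect)
qed

section \<open>The character relating two eigenforms\<close>

text \<open>
  The coefficients of a completed eigenform: \<open>I\<close> is the set of classes \<open>i\<close> of the family, \<open>u i\<close> is
  the coefficient \<open>\<beta>\<close> of the member \<open>(i/b, s\<^sub>i)\<close>, and \<open>C i\<close> is the series of that member in powers
  of \<open>q\<^sup>b\<close>.
\<close>
locale hecke_system =
  fixes b :: nat and I :: "nat set" and C :: "nat \<Rightarrow> nat \<Rightarrow> complex"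
    and u :: "nat \<Rightarrow> complex" and a :: "nat \<Rightarrow> complex"
  assumes coeff: "a n = (if n mod b \<in> I then u (n mod b) * C (n mod b) (n div b) else 0)"
    and mult: "prime p \<Longrightarrow> 3 < p \<Longrightarrow> \<not> p dvd n \<Longrightarrow> a (p * n) = a p * a n"
    and classes_less: "i \<in> I \<Longrightarrow> i < b"
    and one_class: "1 \<in> I" and u_1: "u 1 = 1" and C_0: "i \<in> I \<Longrightarrow> C i 0 = 1"
begin

lemma coeff_class: "i \<in> I \<Longrightarrow> a i = u i"
  using classes_less[of i] by (simp add: coeff C_0)

lemma class_coeff_nonzero:
  assumes "a n \<noteq> 0"
  shows "n mod b \<in> I" and "u (n mod b) \<noteq> 0"
  using assms by (auto simp: coeff split: if_splits)

text \<open>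
  A product in the class of 1 has a coefficient that does not involve the unknown \<open>u\<close>. This is how
  \<open>u\<close> is seen to be nonzero at other classes.
\<close>
lemma coeff_factor_nonzero:
  assumes "prime p" "3 < p" "\<not> p dvd n" and "p * n mod b = 1" and "C 1 (p * n div b) \<noteq> 0"
  shows "a p \<noteq> 0" and "a n \<noteq> 0"
proof -
  have "a (p * n) \<noteq> 0" using assms one_class u_1 by (simp add: coeff)
  then show "a p \<noteq> 0" "a n \<noteq> 0" using mult[OF assms(1-3)] by auto
qed

lemma u_product_nonzero:
  assumes "prime p" "3 < p" "\<not> p dvd n" and "a p \<noteq> 0" "a n \<noteq> 0"
  shows "u (p * n mod b) \<noteq> 0"
  using assms mult[OF assms(1-3)] by (intro class_coeff_nonzero) auto

end

text \<open>
  Two eigenforms for reflected families, in the case of an even \<open>b\<close>. Then all classes are odd,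
  which makes the sign \<open>(-1)\<^bsup>\<lfloor>n/b\<rfloor>\<^esup>\<close> compatible with products.
\<close>
locale reflected_hecke_systems =
  S: hecke_system b I C u a + S': hecke_system b I "\<lambda>i k. (- 1) ^ k * C i k" u' a'
  for b I C u a u' a' +
  assumes even_b: "even b" and odd_class: "i \<in> I \<Longrightarrow> odd i"
    and u_nonzero: "i \<in> I \<Longrightarrow> u i \<noteq> 0" and u'_nonzero: "i \<in> I \<Longrightarrow> u' i \<noteq> 0"
begin

definition in_class :: "int \<Rightarrow> bool" where
  "in_class x \<longleftrightarrow> nat (x mod int b) \<in> I"

definition psi :: "int \<Rightarrow> complex" where
  "psi x = u (nat (x mod int b)) / u' (nat (x mod int b)) * (if even (x div int b) then 1 else - 1)"

lemma b_pos: "b > 0"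
  using S.classes_less[OF S.one_class] by simp

lemma in_class_shift: "in_class (x + k * int b) \<longleftrightarrow> in_class x"
  by (simp add: in_class_def)

lemma in_class_imp_odd:
  assumes "in_class x"
  shows "odd x"
proof -
  have "odd (nat (x mod int b))" using assms odd_class by (simp add: in_class_def)
  then have "odd (x mod int b)" using b_pos by (simp add: even_nat_iff)
  moreover have "x = x mod int b + int b * (x div int b)" by simp
  ultimately show ?thesis using even_b by (metis even_add even_mult_iff even_of_nat)
qed

lemma psi_shift: "psi (x + k * int b) = (if even k then 1 else - 1) * psi x"
  using b_pos by (auto simp: psi_def)

lemma psi_nonzero: "in_class x \<Longrightarrow> psi x \<noteq> 0"
  using u_nonzero u'_nonzero by (auto simp: psi_def in_class_def)

lemma psi_1: "psi 1 = 1"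
  using S.classes_less[OF S.one_class] S.u_1 S'.u_1 by (simp add: psi_def)

lemma in_class_of_nat: "in_class (int n) \<longleftrightarrow> n mod b \<in> I"
  by (simp add: in_class_def flip: zmod_int)

lemma coeff_eq_psi: "in_class (int n) \<Longrightarrow> a n = psi (int n) * a' n"
  using u'_nonzero[of "n mod b"]
  by (simp add: S.coeff S'.coeff psi_def in_class_of_nat zdiv_int[symmetric] zmod_int[symmetric])

text \<open>
  The elements at which \<open>psi\<close> is multiplicative against everything are closed under products, so
  that only generators have to be tested.
\<close>
definition psi_mult_at :: "int \<Rightarrow> bool" where
  "psi_mult_at x \<longleftrightarrow> in_class x \<and> (\<forall>y. in_class y \<longrightarrow> in_class (x * y) \<and> psi (x * y) = psi x * psi y)"

lemma psi_mult_at_1: "psi_mult_at 1"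
  using S.one_class S.classes_less[OF S.one_class] by (simp add: psi_mult_at_def psi_1 in_class_def)

lemma psi_mult_at_mult: "psi_mult_at x \<Longrightarrow> psi_mult_at y \<Longrightarrow> psi_mult_at (x * y)"
  by (simp add: psi_mult_at_def mult.assoc)

lemma psi_mult_at_cong:
  assumes x: "psi_mult_at x" and "x mod int b = x' mod int b"
  shows "psi_mult_at x'"
proof -
  define k where "k = x' div int b - x div int b"
  have x': "x' = x + k * int b"
    using assms(2) unfolding k_def by (metis add_diff_cancel_left' left_diff_distrib minus_mod_eq_div_mult diff_diff_eq2 add.commute diff_add_cancel)
  show ?thesis
    unfolding psi_mult_at_def
  proof (intro conjI allI impI)
    show "in_class x'" using x by (simp add: psi_mult_at_def x' in_class_shift)
    fix y assume y: "in_class y"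
    have eq: "x' * y = x * y + (k * y) * int b" by (simp add: x' algebra_simps)
    show "in_class (x' * y)"
      using x y by (simp add: psi_mult_at_def eq in_class_shift del: mult.assoc)
    show "psi (x' * y) = psi x' * psi y"
    proof -
      have "psi (x' * y) = (if even (k * y) then 1 else - 1) * psi (x * y)"
        by (simp only: eq psi_shift)
      moreover have "psi x' = (if even k then 1 else - 1) * psi x"
        by (simp only: x' psi_shift)
      ultimately show ?thesis using x y in_class_imp_odd[OF y] by (simp add: psi_mult_at_def)
    qed
  qed
qed

text \<open>
  For each class \<open>j\<close> one representative \<open>m\<close> with \<open>\<not> p dvd m\<close> and nonvanishing coefficients is
  enough, since \<open>psi\<close> is controlled along classes. The representative \<open>m = j\<close> has coefficient
  \<open>u j\<close>; it fails only if \<open>p\<close> divides \<open>j\<close>, and for that class \<open>n\<close> is used.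
\<close>
lemma psi_mult_at_prime:
  assumes p: "prime p" "3 < p" and n: "\<not> p dvd n" "p * n mod b = 1" "C 1 (p * n div b) \<noteq> 0"
    and cop: "\<And>j. j \<in> I \<Longrightarrow> j = n mod b \<or> \<not> p dvd j"
  shows "psi_mult_at (int p)"
proof -
  have nz: "a p \<noteq> 0" "a n \<noteq> 0" "a' p \<noteq> 0" "a' n \<noteq> 0"
    using S.coeff_factor_nonzero[OF p n] S'.coeff_factor_nonzero[OF p n(1,2)] n(3) by auto
  have clp: "in_class (int p)" using S.class_coeff_nonzero[OF nz(1)] by (simp add: in_class_of_nat)
  have mult: "in_class (int p * int m) \<and> psi (int p * int m) = psi (int p) * psi (int m)"
    if m: "\<not> p dvd m" "a m \<noteq> 0" "a' m \<noteq> 0" for m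
  proof -
    have "a (p * m) \<noteq> 0" using S.mult[OF p m(1)] nz m by simp
    then have cl: "in_class (int p * int m)" 
      using S.class_coeff_nonzero[of "p * m"] by (simp add: in_class_of_nat flip: of_nat_mult)
    have clm: "in_class (int m)" using S.class_coeff_nonzero[OF m(2)] by (simp add: in_class_of_nat)
    have "psi (int p * int m) * (a' p * a' m) = a (p * m)"
      using coeff_eq_psi[of "p * m"] cl S'.mult[OF p m(1)] by simp
    also have "\<dots> = (psi (int p) * psi (int m)) * (a' p * a' m)"
      using S.mult[OF p m(1)] coeff_eq_psi[OF clp] coeff_eq_psi[OF clm] by simp
    finally show ?thesis using cl nz m by simp
  qed
  show ?thesis
    unfolding psi_mult_at_def
  proof (intro conjI allI impI)
    fix y assume y: "in_class y"
    define j where "j = nat (y mod int b)"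
    have j: "j \<in> I" using y by (simp add: j_def in_class_def)
    obtain m where m: "\<not> p dvd m" "a m \<noteq> 0" "a' m \<noteq> 0" "m mod b = j"
    proof (cases "j = n mod b")
      case True
      then show ?thesis using that n nz by blast
    next
      case False
      then show ?thesis
        using that[of j] cop[OF j] S.coeff_class[OF j] S'.coeff_class[OF j] u_nonzero[OF j] u'_nonzero[OF j]
          S.classes_less[OF j] by simp
    qed
    have "int m mod int b = y mod int b"
      using m(4) b_pos by (simp add: j_def flip: zmod_int)
    define k where "k = y div int b - int m div int b"
    have y_eq: "y = int m + k * int b"
      using \<open>int m mod int b = y mod int b\<close> unfolding k_def
      by (metis add_diff_cancel_left' left_diff_distrib minus_mod_eq_div_mult diff_diff_eq2 add.commute diff_add_cancel)
    have eq: "int p * y = int p * int m + (int p * k) * int b" by (simp add: y_eq algebra_simps)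
    show "in_class (int p * y)" unfolding eq in_class_shift using mult[OF m(1-3)] by blast
    show "psi (int p * y) = psi (int p) * psi y"
    proof -
      have "psi (int p * y) = (if even (int p * k) then 1 else - 1) * psi (int p * int m)"
        by (simp only: eq psi_shift)
      moreover have "psi y = (if even k then 1 else - 1) * psi (int m)"
        by (simp only: y_eq psi_shift)
      ultimately show ?thesis using mult[OF m(1-3)] in_class_imp_odd[OF clp] by simp
    qed
  qed (rule clp)
qed

text \<open>
  If the classes do not exhaust the units modulo \<open>b\<close>, then the missing ones are the negatives of
  those that occur, and the value at a missing \<open>x\<close> is taken at \<open>-x\<close>.
\<close>
definition chi :: "int \<Rightarrow> complex" where
  "chi x = (if in_class x then psi x else if in_class (- x) then psi (- x) else 0)"

text \<open>
  Among the alternatives in the last hypothesis, the first says that the classes are all units,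
  and the second that exactly one of \<open>x\<close> and \<open>-x\<close> occurs. In the latter case the sign that moves a
  unit into a class is itself multiplicative.
\<close>
lemma dirichlet_character_chi:
  assumes mult: "\<And>x. in_class x \<Longrightarrow> psi_mult_at x"
    and cover: "\<And>x. coprime x (int b) \<longleftrightarrow> in_class x \<or> in_class (- x)"
    and alt: "(\<forall>x. in_class x \<longrightarrow> in_class (- x)) \<or> (\<forall>x. in_class x \<longrightarrow> \<not> in_class (- x))"
  shows "dirichlet_character (2 * b) chi"
  unfolding dirichlet_character_def
proof (intro conjI allI)
  have m: "in_class (x * y)" "psi (x * y) = psi x * psi y" if "in_class x" "in_class y" for x y
    using mult[OF that(1)] that(2) by (auto simp: psi_mult_at_def)
  show "2 * b > 0" using b_pos by simp
  show "chi 1 = 1"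
    using psi_mult_at_1 by (simp add: chi_def psi_1 psi_mult_at_def)
  fix x y
  show "chi (x + int (2 * b)) = chi x"
  proof -
    have 1: "x + int (2 * b) = x + 2 * int b" "- (x + 2 * int b) = - x + (- 2) * int b" by simp_all
    show ?thesis unfolding chi_def by (simp only: 1 in_class_shift psi_shift) simp
  qed
  have zero: "chi x = 0 \<longleftrightarrow> \<not> coprime x (int b)" for x
    by (auto simp: chi_def cover psi_nonzero)
  have "coprime x 2" if "coprime x (int b)"
    using that even_b coprime_divisors[OF dvd_refl, of 2 "int b" x] by simp
  then have "coprime x (int (2 * b)) \<longleftrightarrow> coprime x (int b)"
    unfolding of_nat_mult coprime_mult_right_iff by auto
  with zero[of x] show "chi x = 0 \<longleftrightarrow> \<not> coprime x (int (2 * b))" by simp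
  show "chi (x * y) = chi x * chi y"
  proof (cases "coprime x (int b) \<and> coprime y (int b)")
    case False
    then have "chi x = 0 \<or> chi y = 0" "chi (x * y) = 0" unfolding zero by auto
    then show ?thesis by auto
  next
    case True
    then have xy: "in_class x \<or> in_class (- x)" "in_class y \<or> in_class (- y)" by (simp_all add: cover)
    show ?thesis
    proof (cases "in_class x")
      case x: True
      show ?thesis
      proof (cases "in_class y")
        case True
        then show ?thesis using x m by (simp add: chi_def)
      next
        case False
        then have "in_class (- y)" "\<forall>x. in_class x \<longrightarrow> \<not> in_class (- x)" using xy alt by force+
        then show ?thesis using x False m[of x "- y"] by (auto simp: chi_def)
      qed
    next
      case x: False
      then have x': "in_class (- x)" and a: "\<forall>x. in_class x \<longrightarrow> \<not> in_class (- x)" using xy alt by force+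
      show ?thesis
      proof (cases "in_class y")
        case True
        then show ?thesis using x x' a m[of "- x" y] by (auto simp: chi_def)
      next
        case False
        then have "in_class (- y)" using xy by simp
        then show ?thesis using x x' a False m[of "- x" "- y"] by (auto simp: chi_def)
      qed
    qed
  qed
qed

lemma coeff_eq_chi: "a n = chi (int n) * a' n"
proof (cases "in_class (int n)")
  case True
  then show ?thesis by (simp add: chi_def coeff_eq_psi)
next
  case False
  then show ?thesis by (simp add: S.coeff S'.coeff in_class_of_nat)
qed

end

section \<open>Numerical coefficients\<close>

lemma divisor_sum_eq_filter: "divisor_sum n = sum_list [d \<leftarrow> [1..<Suc n]. n mod d = 0]"
proof -
  have "sum_list [d \<leftarrow> [1..<Suc n]. n mod d = 0] = (\<Sum>d\<in>set [d \<leftarrow> [1..<Suc n]. n mod d = 0]. d)"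
    using sum_list_distinct_conv_sum_set[of "[d \<leftarrow> [1..<Suc n]. n mod d = 0]" "\<lambda>d. d"]
    by (simp only: distinct_filter distinct_upt map_ident)
  also have "set [d \<leftarrow> [1..<Suc n]. n mod d = 0] = {d. d dvd n \<and> n > 0}"
    by (auto simp: dvd_eq_mod_eq_0[symmetric] dvd_imp_le less_Suc_eq_le Suc_le_eq intro: dvd_pos_nat simp del: upt_Suc)
  finally show ?thesis by (simp add: divisor_sum_def)
qed

lemma upt_1_Cons: "1 < n \<Longrightarrow> [Suc 0..<n] = Suc 0 # [2..<n]"
  by (simp add: upt_conv_Cons numeral_2_eq_2)

lemma divisor_sum_table:
  "divisor_sum (Suc 0) = 1" "divisor_sum 2 = 3" "divisor_sum 3 = 4" "divisor_sum 4 = 7"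
  "divisor_sum 5 = 6" "divisor_sum 6 = 12" "divisor_sum 7 = 8" "divisor_sum 8 = 15"
  "divisor_sum 9 = 13" "divisor_sum 10 = 18" "divisor_sum 11 = 12" "divisor_sum 12 = 28"
  "divisor_sum 13 = 14" "divisor_sum 14 = 24" "divisor_sum 15 = 24" "divisor_sum 16 = 31"
  "divisor_sum 17 = 18" "divisor_sum 18 = 39" "divisor_sum 19 = 20" "divisor_sum 20 = 42"
  by (simp_all add: divisor_sum_eq_filter upt_1_Cons del: upt_Suc)

text \<open>
  Checks a list \<open>c\<^sub>n, \<dots>, c\<^sub>0\<close> against the recursion of \<open>exp_coeff_Suc\<close>, where \<open>ws\<close> lists the
  weights from \<open>w\<^sub>1\<close> on. Verifying a given list is much cheaper than evaluating \<open>exp_coeffs\<close>.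
\<close>
fun newton_rec :: "rat list \<Rightarrow> rat list \<Rightarrow> bool" where
  "newton_rec ws [] \<longleftrightarrow> False"
| "newton_rec ws [c] \<longleftrightarrow> c = 1"
| "newton_rec ws (c # c' # cs) \<longleftrightarrow>
     of_nat (length (c' # cs)) * c = sum_list (map2 (*) ws (c' # cs)) \<and> newton_rec ws (c' # cs)"

lemma newton_rec_exp_coeffs:
  assumes "newton_rec (map w [1..<N]) cs" and "length cs \<le> N"
  shows "cs = exp_coeffs w (length cs - 1)"
  using assms
proof (induction cs rule: induct_list012)
  case (3 c c' cs)
  define n where "n = length cs"
  have IH: "c' # cs = exp_coeffs w n" using 3 by (simp add: n_def)
  have "map2 (*) (map w [1..<N]) (c' # cs) = map2 (\<lambda>j c. w j * c) [1..<n + 2] (c' # cs)"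
    using "3.prems"(2) by (intro nth_equalityI) (simp_all add: n_def del: upt_Suc)
  then have "of_nat (Suc n) * c = (\<Sum>(j, c)\<leftarrow>zip [1..<n + 2] (c' # cs). w j * c)"
    using "3.prems"(1) by (simp add: n_def del: upt_Suc of_nat_Suc)
  then have "(\<Sum>(j, c)\<leftarrow>zip [1..<n + 2] (c' # cs). w j * c) / of_nat (Suc n) = c"
    by (simp add: field_simps del: upt_Suc of_nat_Suc)
  then have "exp_coeffs w (Suc n) = c # c' # cs"
    unfolding exp_coeffs.simps Let_def IH[symmetric] by (simp only:)
  then show ?case by (simp add: n_def)
qed auto

lemma exp_coeff_eq_nth:
  assumes "newton_rec (map w [1..<length cs]) cs" and "n < length cs"
  shows "exp_coeff w n = cs ! (length cs - 1 - n)"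
proof -
  define m where "m = length cs - 1"
  have "cs = map (\<lambda>i. exp_coeff w (m - i)) [0..<Suc m]"
    using newton_rec_exp_coeffs[OF assms(1) order_refl] exp_coeffs_eq[of w m] by (simp add: m_def)
  then have "cs ! (m - n) = map (\<lambda>i. exp_coeff w (m - i)) [0..<Suc m] ! (m - n)"
    by (rule arg_cong)
  also have "\<dots> = exp_coeff w n"
    using assms(2) by (subst nth_map) (auto simp: m_def simp del: upt_Suc)
  finally show ?thesis by (simp add: m_def)
qed

lemma K2_coeff_eq_nth:
  assumes "newton_rec (map (K2_log_weight r s) [1..<N]) cs" and "N = length cs" and "n < N"
  shows "K2_coeff r s n = cs ! (N - 1 - n)"
  using exp_coeff_eq_nth assms by (simp add: K2_coeff_def)

lemmas newton_eval = K2_log_weight_def divisor_sum_table upt_1_Cons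

text \<open>
  In \<open>K2_coeffs_b_j\<close> the pair is \<open>(1/b, j/24)\<close>. The exponents are those \<open>k\<close> for which \<open>1 + k b\<close> is
  one of the products \<open>p n\<close> that the next section uses.
\<close>
lemma K2_coeffs_24_14:
  shows "K2_coeff (1 / 24) (7 / 12) 6 = -28"
    and "K2_coeff (1 / 24) (7 / 12) 9 = 168"
    and "K2_coeff (1 / 24) (7 / 12) 20 = 112"
proof -
  have "newton_rec (map (K2_log_weight (1 / 24) (7 / 12)) [1..<21])
       [112, -542, -466, 418, 224, -535, -42, 470, 159, -252, -166, 168, 70, -153, -28,
        89, 18, -26, -7, 3, 1]"
    by (simp add: newton_eval)
  note nth = K2_coeff_eq_nth[OF this]
  show "K2_coeff (1 / 24) (7 / 12) 6 = -28"
    "K2_coeff (1 / 24) (7 / 12) 9 = 168"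
    "K2_coeff (1 / 24) (7 / 12) 20 = 112"
    by (simp_all add: nth)
qed

lemma K2_coeffs_24_17:
  shows "K2_coeff (1 / 24) (17 / 24) 6 = -120"
    and "K2_coeff (1 / 24) (17 / 24) 9 = 60"
    and "K2_coeff (1 / 24) (17 / 24) 20 = 720"
proof -
  have "newton_rec (map (K2_log_weight (1 / 24) (17 / 24)) [1..<21])
       [720, -130, -370, 62, 480, -297, -550, 230, 351, -72, -202, 60, 170, -71, -120,
        39, 50, -10, -11, 1, 1]"
    by (simp add: newton_eval)
  note nth = K2_coeff_eq_nth[OF this]
  show "K2_coeff (1 / 24) (17 / 24) 6 = -120"
    "K2_coeff (1 / 24) (17 / 24) 9 = 60"
    "K2_coeff (1 / 24) (17 / 24) 20 = 720"
    by (simp_all add: nth)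
qed

lemma K2_coeffs_12_16:
  shows "K2_coeff (1 / 12) (2 / 3) 7 = -96"
    and "K2_coeff (1 / 12) (2 / 3) 11 = -96"
proof -
  have "newton_rec (map (K2_log_weight (1 / 12) (2 / 3)) [1..<12])
       [-96, -135, 66, 94, -96, -66, 62, 33, -18, -9, 2, 1]"
    by (simp add: newton_eval)
  note nth = K2_coeff_eq_nth[OF this]
  show "K2_coeff (1 / 12) (2 / 3) 7 = -96"
    "K2_coeff (1 / 12) (2 / 3) 11 = -96"
    by (simp_all add: nth)
qed

lemma K2_coeffs_8_12:
  shows "K2_coeff (1 / 8) (1 / 2) 4 = -28"
proof -
  have "newton_rec (map (K2_log_weight (1 / 8) (1 / 2)) [1..<5])
       [-28, -25, 2, 5, 1]"
    by (simp add: newton_eval)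
  note nth = K2_coeff_eq_nth[OF this]
  show "K2_coeff (1 / 8) (1 / 2) 4 = -28"
    by (simp_all add: nth)
qed

lemma K2_coeffs_8_15:
  shows "K2_coeff (1 / 8) (5 / 8) 8 = 48"
    and "K2_coeff (1 / 8) (5 / 8) 13 = 192"
proof -
  have "newton_rec (map (K2_log_weight (1 / 8) (5 / 8)) [1..<14])
       [192, 26, -102, -99, 58, 48, -84, -15, 66, 12, -23, -6, 3, 1]"
    by (simp add: newton_eval)
  note nth = K2_coeff_eq_nth[OF this]
  show "K2_coeff (1 / 8) (5 / 8) 8 = 48"
    "K2_coeff (1 / 8) (5 / 8) 13 = 192"
    by (simp_all add: nth)
qed

lemma K2_coeffs_8_18:
  shows "K2_coeff (1 / 8) (3 / 4) 8 = 80"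
    and "K2_coeff (1 / 8) (3 / 4) 13 = 128"
proof -
  have "newton_rec (map (K2_log_weight (1 / 8) (3 / 4)) [1..<14])
       [128, 150, -22, -71, 10, 80, -40, -79, 30, 40, -9, -10, 1, 1]"
    by (simp add: newton_eval)
  note nth = K2_coeff_eq_nth[OF this]
  show "K2_coeff (1 / 8) (3 / 4) 8 = 80"
    "K2_coeff (1 / 8) (3 / 4) 13 = 128"
    by (simp_all add: nth)
qed

lemma K2_coeffs_6_20:
  shows "K2_coeff (1 / 6) (5 / 6) 14 = -128"
proof -
  have "newton_rec (map (K2_log_weight (1 / 6) (5 / 6)) [1..<15])
       [-128, 0, 110, 0, -22, 0, 49, 0, -70, 0, 39, 0, -10, 0, 1]"
    by (simp add: newton_eval)
  note nth = K2_coeff_eq_nth[OF this]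
  show "K2_coeff (1 / 6) (5 / 6) 14 = -128"
    by (simp_all add: nth)
qed

lemma K2_coeffs_4_18:
  shows "K2_coeff (1 / 4) (3 / 4) 5 = 32"
proof -
  have "newton_rec (map (K2_log_weight (1 / 4) (3 / 4)) [1..<6])
       [32, 18, -14, -7, 2, 1]"
    by (simp add: newton_eval)
  note nth = K2_coeff_eq_nth[OF this]
  show "K2_coeff (1 / 4) (3 / 4) 5 = 32"
    by (simp_all add: nth)
qed

lemma K2_coeffs_3_16:
  shows "K2_coeff (1 / 3) (2 / 3) 3 = -16"
proof -
  have "newton_rec (map (K2_log_weight (1 / 3) (2 / 3)) [1..<4])
       [-16, 0, 4, 1]"
    by (simp add: newton_eval)
  note nth = K2_coeff_eq_nth[OF this]
  show "K2_coeff (1 / 3) (2 / 3) 3 = -16"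
    by (simp_all add: nth)
qed

section \<open>Generators of the residue classes\<close>

text \<open>
  The possible denominators and sets of classes of a Galois family with \<open>b > 1\<close>, with those
  coefficients \<open>c k\<close> of the member \<open>(1/b, s\<^sub>1)\<close> whose nonvanishing forces all \<open>\<beta>\<close> to be nonzero.
  Each \<open>k\<close> stems from a factorization \<open>1 + k b = p n\<close> where \<open>p\<close> is a prime in a class that is
  needed as a generator: for \<open>b = 24\<close> these are 5 \<open>\<cdot>\<close> 29, 7 \<open>\<cdot>\<close> 31 and 13 \<open>\<cdot>\<close> 37.
\<close>
inductive generating_data :: "nat \<Rightarrow> nat set \<Rightarrow> (nat \<Rightarrow> 'a :: zero) \<Rightarrow> bool" where
  "c 6 \<noteq> 0 \<Longrightarrow> c 9 \<noteq> 0 \<Longrightarrow> c 20 \<noteq> 0 \<Longrightarrow> generating_data 24 {1, 5, 7, 11, 13, 17, 19, 23} c"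
| "c 7 \<noteq> 0 \<Longrightarrow> c 11 \<noteq> 0 \<Longrightarrow> generating_data 12 {1, 5, 7, 11} c"
| "c 8 \<noteq> 0 \<Longrightarrow> c 13 \<noteq> 0 \<Longrightarrow> generating_data 8 {1, 3, 5, 7} c"
| "c 4 \<noteq> 0 \<Longrightarrow> generating_data 8 {1, 3} c"
| "c 14 \<noteq> 0 \<Longrightarrow> generating_data 6 {1, 5} c"
| "c 5 \<noteq> 0 \<Longrightarrow> generating_data 4 {1, 3} c"
| "generating_data 4 {1} c"
| "c 3 \<noteq> 0 \<Longrightarrow> generating_data 3 {1, 2} c"
| "generating_data 2 {1} c"

context hecke_system
begin

lemma factor_nonzero:
  assumes "prime p" "3 < p" "\<not> p dvd n" and "p * n = 1 + k * b" "b > 1" and "C 1 k \<noteq> 0"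
  shows "u (p mod b) \<noteq> 0" "a p \<noteq> 0" "a n \<noteq> 0"
proof -
  have "p * n mod b = 1" "p * n div b = k"
    unfolding assms(4) mod_mult_self1 using assms(5) by (simp_all only: div_mult_self1) simp_all
  then show "a p \<noteq> 0" "a n \<noteq> 0" using coeff_factor_nonzero[OF assms(1-3)] assms(6) by auto
  then show "u (p mod b) \<noteq> 0" by (intro class_coeff_nonzero)
qed

lemma product_nonzero:
  assumes "prime p" "3 < p" "\<not> p dvd n" "p \<in> I" "n \<in> I" "u p \<noteq> 0" "u n \<noteq> 0"
  shows "u (p * n mod b) \<noteq> 0"
  using assms by (intro u_product_nonzero) (simp_all add: coeff_class)

text \<open>
  Generators are reached through \<open>factor_nonzero\<close>, and the remaining classes are products of two
  classes already reached. If 1 and 3 are the only classes, then the class 3 is reached by the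
  prime 11 or 7, since the eigenform property says nothing at the prime 3.
\<close>
lemma u_nonzero_of_generating_data:
  assumes gen: "generating_data b I (C 1)" and i: "i \<in> I"
  shows "u i \<noteq> 0"
  using gen
proof (cases rule: generating_data.cases)
  case 1
  have 5: "u 5 \<noteq> 0" using factor_nonzero(1)[of 5 29 6] 1 by simp
  have 7: "u 7 \<noteq> 0" using factor_nonzero(1)[of 7 31 9] 1 by simp
  have 13: "u 13 \<noteq> 0" using factor_nonzero(1)[of 13 37 20] 1 by simp
  have 11: "u 11 \<noteq> 0" using product_nonzero[of 5 7] 5 7 1 by simp
  have "u 17 \<noteq> 0" "u 19 \<noteq> 0" "u 23 \<noteq> 0"
    using product_nonzero[of 5 13] product_nonzero[of 7 13] product_nonzero[of 11 13] 5 7 11 13 1 by simp_all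
  with 5 7 11 13 show ?thesis using i u_1 unfolding 1 by auto
next
  case 2
  have 5: "u 5 \<noteq> 0" using factor_nonzero(1)[of 5 17 7] 2 by simp
  have 7: "u 7 \<noteq> 0" using factor_nonzero(1)[of 7 19 11] 2 by simp
  have "u 11 \<noteq> 0" using product_nonzero[of 5 7] 5 7 2 by simp
  with 5 7 show ?thesis using i u_1 unfolding 2 by auto
next
  case 3
  have 5: "u 5 \<noteq> 0" using factor_nonzero(1)[of 5 13 8] 3 by simp
  have 7: "u 7 \<noteq> 0" using factor_nonzero(1)[of 7 15 13] 3 by simp
  have "u 3 \<noteq> 0" using product_nonzero[of 5 7] 5 7 3 by simp
  with 5 7 show ?thesis using i u_1 unfolding 3 by auto
next
  case 4
  then have "u 3 \<noteq> 0" using factor_nonzero(1)[of 11 3 4] by simp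
  then show ?thesis using i u_1 unfolding 4 by auto
next
  case 5
  then have "u 5 \<noteq> 0" using factor_nonzero(1)[of 5 17 14] by simp
  then show ?thesis using i u_1 unfolding 5 by auto
next
  case 6
  then have "u 3 \<noteq> 0" using factor_nonzero(1)[of 7 3 5] by simp
  then show ?thesis using i u_1 unfolding 6 by auto
next
  case 8
  then have "u 2 \<noteq> 0" using factor_nonzero(1)[of 5 2 3] by simp
  then show ?thesis using i u_1 unfolding 8 by auto
qed (use i u_1 in auto)

end

context reflected_hecke_systems
begin

lemma psi_mult_at_generator:
  assumes "prime p" "3 < p" "\<not> p dvd n" and "p * n = 1 + k * b" "b > 1" and "C 1 k \<noteq> 0"
    and "\<And>j. j \<in> I \<Longrightarrow> j = n mod b \<or> \<not> p dvd j" and "x = int p"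
  shows "psi_mult_at x"
proof -
  have "p * n mod b = 1" "p * n div b = k"
    unfolding assms(4) mod_mult_self1 using assms(5) by (simp_all only: div_mult_self1) simp_all
  then show ?thesis unfolding assms(8) using assms(1-7) by (intro psi_mult_at_prime[of p n]) auto
qed

lemma psi_mult_at_of_generating_data:
  assumes gen: "generating_data b I (C 1)" and x: "in_class x"
  shows "psi_mult_at x"
proof -
  have cl: "nat (x mod int b) \<in> I" using x by (simp add: in_class_def)
  have res: "psi_mult_at x" if "psi_mult_at y" "int (nat (x mod int b)) = y mod int b" for y
    using psi_mult_at_cong[OF that(1), of x] that(2) b_pos by simp
  show ?thesis
    using gen
  proof (cases rule: generating_data.cases)
    case 1
    have 5: "psi_mult_at 5" by (rule psi_mult_at_generator[of 5 29 6]) (use 1 in auto)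
    have 7: "psi_mult_at 7" by (rule psi_mult_at_generator[of 7 31 9]) (use 1 in auto)
    have 13: "psi_mult_at 13" by (rule psi_mult_at_generator[of 13 37 20]) (use 1 in auto)
    from psi_mult_at_mult[OF 5 7] psi_mult_at_mult[OF 5 13] psi_mult_at_mult[OF 7 13]
      psi_mult_at_mult[OF psi_mult_at_mult[OF 5 7] 13] 
    show ?thesis
      using cl res[of 1] res[OF 5] res[OF 7] res[OF 13] res[of "5 * 7"] res[of "5 * 13"] res[of "7 * 13"]
        res[of "5 * 7 * 13"] psi_mult_at_1 unfolding 1 by auto
  next
    case 2
    have 5: "psi_mult_at 5" by (rule psi_mult_at_generator[of 5 17 7]) (use 2 in auto)
    have 7: "psi_mult_at 7" by (rule psi_mult_at_generator[of 7 19 11]) (use 2 in auto)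
    from psi_mult_at_mult[OF 5 7] show ?thesis
      using cl res[of 1] res[OF 5] res[OF 7] res[of "5 * 7"] psi_mult_at_1 unfolding 2 by auto
  next
    case 3
    have 5: "psi_mult_at 5" by (rule psi_mult_at_generator[of 5 13 8]) (use 3 in auto)
    have 7: "psi_mult_at 7" by (rule psi_mult_at_generator[of 7 15 13]) (use 3 in auto)
    from psi_mult_at_mult[OF 5 7] show ?thesis
      using cl res[of 1] res[OF 5] res[OF 7] res[of "5 * 7"] psi_mult_at_1 unfolding 3 by auto
  next
    case 4
    have "psi_mult_at 11" by (rule psi_mult_at_generator[of 11 3 4]) (use 4 in auto)
    then show ?thesis using cl res[of 1] res[of 11] psi_mult_at_1 unfolding 4 by auto
  next
    case 5
    have "psi_mult_at 5" by (rule psi_mult_at_generator[of 5 17 14]) (use 5 in auto)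
    then show ?thesis using cl res[of 1] res[of 5] psi_mult_at_1 unfolding 5 by auto
  next
    case 6
    have "psi_mult_at 7" by (rule psi_mult_at_generator[of 7 3 5]) (use 6 in auto)
    then show ?thesis using cl res[of 1] res[of 7] psi_mult_at_1 unfolding 6 by auto
  next
    case 8
    then show ?thesis using even_b by simp
  qed (use cl res[of 1] psi_mult_at_1 in auto)
qed

text \<open>
  The classes are determined modulo \<open>b\<close>, so the hypotheses of \<open>dirichlet_character_chi\<close> on units
  and on \<open>\<plusminus>x\<close> are finite checks.
\<close>
lemma dirichlet_character_chi_of_generating_data:
  assumes gen: "generating_data b I (C 1)"
  shows "dirichlet_character (2 * b) chi"
proof (rule dirichlet_character_chi)
  have mem: "x mod int b \<in> set [0..int b - 1]" for x using b_pos by simp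
  have neg: "in_class (- x) \<longleftrightarrow> nat ((- (x mod int b)) mod int b) \<in> I" for x
    by (simp add: in_class_def mod_minus_eq)
  have "\<forall>y\<in>set [0..int b - 1]. coprime y (int b) \<longleftrightarrow> nat y \<in> I \<or> nat ((- y) mod int b) \<in> I"
    using gen
  proof (cases rule: generating_data.cases)
    case 1 show ?thesis unfolding 1 by code_simp
  next
    case 2 show ?thesis unfolding 2 by code_simp
  next
    case 3 show ?thesis unfolding 3 by code_simp
  next
    case 4 show ?thesis unfolding 4 by code_simp
  next
    case 5 show ?thesis unfolding 5 by code_simp
  next
    case 6 show ?thesis unfolding 6 by code_simp
  next
    case 7 show ?thesis unfolding 7 by code_simp
  next
    case 8 then show ?thesis using even_b by simp
  next
    case 9 show ?thesis unfolding 9 by code_simp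
  qed
  from bspec[OF this mem] show "coprime x (int b) \<longleftrightarrow> in_class x \<or> in_class (- x)" for x
    unfolding neg unfolding in_class_def using b_pos
    by (metis coprime_mod_left_iff less_irrefl of_nat_0_eq_iff)
  have "(\<forall>y\<in>set [0..int b - 1]. nat y \<in> I \<longrightarrow> nat ((- y) mod int b) \<in> I) \<or>
      (\<forall>y\<in>set [0..int b - 1]. nat y \<in> I \<longrightarrow> nat ((- y) mod int b) \<notin> I)"
    using gen
  proof (cases rule: generating_data.cases)
    case 1 show ?thesis unfolding 1 by code_simp
  next
    case 2 show ?thesis unfolding 2 by code_simp
  next
    case 3 show ?thesis unfolding 3 by code_simp
  next
    case 4 show ?thesis unfolding 4 by code_simp
  next
    case 5 show ?thesis unfolding 5 by code_simp
  next
    case 6 show ?thesis unfolding 6 by code_simp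
  next
    case 7 show ?thesis unfolding 7 by code_simp
  next
    case 8 then show ?thesis using even_b by simp
  next
    case 9 show ?thesis unfolding 9 by code_simp
  qed
  then show "(\<forall>x. in_class x \<longrightarrow> in_class (- x)) \<or> (\<forall>x. in_class x \<longrightarrow> \<not> in_class (- x))"
  proof (rule disj_forward)
    assume "\<forall>y\<in>set [0..int b - 1]. nat y \<in> I \<longrightarrow> nat ((- y) mod int b) \<in> I"
    from bspec[OF this mem] show "\<forall>x. in_class x \<longrightarrow> in_class (- x)"
      unfolding neg unfolding in_class_def by (intro allI)
  next
    assume "\<forall>y\<in>set [0..int b - 1]. nat y \<in> I \<longrightarrow> nat ((- y) mod int b) \<notin> I"
    from bspec[OF this mem] show "\<forall>x. in_class x \<longrightarrow> \<not> in_class (- x)"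
      unfolding neg unfolding in_class_def by (intro allI)
  qed
qed (rule psi_mult_at_of_generating_data[OF gen])

end

text \<open>
  Since \<open>10 = 5 \<cdot> 2\<close>, the coefficient of \<open>q\<^sup>1\<^sup>0\<close> determines the squares of \<open>u 2\<close> and \<open>u' 2\<close>, and
  these agree. So the ratio is a sign. For odd \<open>b\<close> the parity of \<open>\<lfloor>n/b\<rfloor>\<close> depends on the parity of
  \<open>n\<close>, which produces the sign in front of the character.
\<close>
lemma dirichlet_character_mod_3:
  assumes S: "hecke_system 3 {1, 2} C u a"
    and S': "hecke_system 3 {1, 2} (\<lambda>i k. (- 1) ^ k * C i k) u' a'"
    and nz: "C 1 3 \<noteq> 0"
  shows "\<exists>chi. dirichlet_character 3 chi \<and> (\<forall>n. a n = (if odd n then 1 else - 1) * chi (int n) * a' n)"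
proof -
  interpret S: hecke_system 3 "{1, 2}" C u a by fact
  interpret S': hecke_system 3 "{1, 2}" "\<lambda>i k. (- 1) ^ k * C i k" u' a' by fact
  have "a 10 = a 5 * a 2" "a' 10 = a' 5 * a' 2"
    using S.mult[of 5 2] S'.mult[of 5 2] by simp_all
  then have "C 1 3 = u 2 ^ 2 * C 2 1" "- C 1 3 = - (u' 2 ^ 2 * C 2 1)"
    using S.u_1 S'.u_1 S.coeff[of 10] S.coeff[of 5] S.coeff_class[of 2]
      S'.coeff[of 10] S'.coeff[of 5] S'.coeff_class[of 2]
    by (simp_all add: power2_eq_square)
  then have "u 2 ^ 2 = u' 2 ^ 2" "u' 2 \<noteq> 0" using nz by auto
  then obtain e where ee: "e * e = 1" "u 2 = - e * u' 2"
    using that[of 1] that[of "- 1"] by (auto simp: power2_eq_iff)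
  define chi where "chi = (\<lambda>x :: int. if x mod 3 = 0 then 0 else if x mod 3 = 1 then 1 else e)"
  have mod3: "x mod 3 = 0 \<or> x mod 3 = 1 \<or> x mod 3 = 2" for x :: int by presburger
  have "dirichlet_character 3 chi"
    unfolding dirichlet_character_def
  proof (intro conjI allI)
    fix x y :: int
    have m: "(x * y) mod 3 = ((x mod 3) * (y mod 3)) mod 3" by (simp add: mod_mult_eq)
    show "chi (x * y) = chi x * chi y"
      unfolding chi_def m using mod3[of x] mod3[of y] ee(1) by (elim disjE) simp_all
    have "coprime x 3 \<longleftrightarrow> \<not> 3 dvd x"
      using prime_imp_coprime[of 3 x] by (auto simp: coprime_commute)
    then show "chi x = 0 \<longleftrightarrow> \<not> coprime x (int 3)"
      using ee by (auto simp: chi_def dvd_eq_mod_eq_0)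
  qed (auto simp: chi_def)
  moreover have "a n = (if odd n then 1 else - 1) * chi (int n) * a' n" for n
  proof -
    have n: "n = n mod 3 + 3 * (n div 3)" by simp
    then have par: "odd n \<longleftrightarrow> odd (n mod 3 + n div 3)" by presburger
    have cases: "n mod 3 = 0 \<or> n mod 3 = 1 \<or> n mod 3 = 2" by presburger
    have chi: "chi (int n) = (if n mod 3 = 0 then 0 else if n mod 3 = 1 then 1 else e)"
    proof -
      have "int n mod 3 = int (n mod 3)" by (simp add: zmod_int)
      then show ?thesis by (simp add: chi_def)
    qed
    have sq: "(- 1 :: complex) ^ k = (if even k then 1 else - 1)" for k :: nat by simp
    show ?thesis
      using cases ee S.u_1 S'.u_1 unfolding par chi S.coeff[of n] S'.coeff[of n] sq
      by (cases "even (n div 3)"; elim disjE) simp_all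
  qed
  ultimately show ?thesis by blast
qed

section \<open>Classification of Galois families\<close>

definition units_24 :: "int list" where
  "units_24 = [1, 5, 7, 11, 13, 17, 19, 23]"

lemma coprime_24_mod: "coprime c 24 \<longleftrightarrow> c mod 24 \<in> set units_24"
proof -
  have "c mod 24 \<in> set [0..23]" by simp
  moreover have "\<forall>y\<in>set [0..23 :: int]. coprime y 24 \<longleftrightarrow> y \<in> set units_24"
    unfolding units_24_def by code_simp
  ultimately show ?thesis by (metis coprime_mod_left_iff zero_neq_numeral)
qed

lemma units_24_coprime: "c \<in> set units_24 \<Longrightarrow> coprime c 24"
  unfolding coprime_24_iff by (auto simp: units_24_def)

lemma conj_grid_iff_units:
  "conj_grid (i, j) (i', j') \<longleftrightarrow> (\<exists>c\<in>set units_24. 24 dvd i - c * i' \<and> 24 dvd j - c * j')"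
proof
  assume "conj_grid (i, j) (i', j')"
  then obtain c where c: "coprime c 24" "24 dvd i - c * i'" "24 dvd j - c * j'"
    by (auto simp: conj_grid_def)
  have "24 dvd x - (c mod 24) * x'" if "24 dvd x - c * x'" for x x'
  proof -
    have "x - (c mod 24) * x' = (x - c * x') + 24 * (c div 24 * x')"
      by (simp add: minus_div_mult_eq_mod[symmetric] algebra_simps)
    with dvd_add[OF that dvd_triv_left] show ?thesis by (simp only:)
  qed
  then show "\<exists>c\<in>set units_24. 24 dvd i - c * i' \<and> 24 dvd j - c * j'"
    using c coprime_24_mod by blast
next
  assume "\<exists>c\<in>set units_24. 24 dvd i - c * i' \<and> 24 dvd j - c * j'"
  then show "conj_grid (i, j) (i', j')" using units_24_coprime by (auto simp: conj_grid_def)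
qed

lemma conj_grid_dvd_3:
  assumes "conj_grid (i, j) (i', j')" "3 dvd i' + j'"
  shows "3 dvd i + j"
proof -
  obtain c where c: "24 dvd i - c * i'" "24 dvd j - c * j'"
    using assms(1) by (auto simp: conj_grid_def)
  have "i + j = (i - c * i') + (j - c * j') + c * (i' + j')" by (simp add: algebra_simps)
  moreover have "3 dvd i - c * i'" "3 dvd j - c * j'" using c by (auto elim: dvd_trans[rotated])
  ultimately show ?thesis using assms(2) by (metis dvd_add dvd_mult)
qed

text \<open>
  If \<open>r > 1\<close>, then both \<open>(r - 1, s)\<close> and \<open>(r - 1, s - 1)\<close> are conjugate to \<open>(r, s)\<close>, and they have
  the same first component.
\<close>
lemma galois_numerator_less:
  assumes "p \<in> grid" "inj_on fst (grid_family p)" "(i, j) \<in> grid_family p" "\<not> 24 dvd i"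
  shows "i < 24"
proof (rule ccontr)
  assume "\<not> i < 24"
  moreover have "i \<noteq> 24" using assms(4) by auto
  ultimately have "24 < i" by simp
  have ij: "(i, j) \<in> grid" "conj_grid p (i, j)" using assms(3) by (auto simp: grid_family_def)
  have "conj_grid (i, j) (i - 24, j)" "conj_grid (i, j) (i - 24, j - 24)"
    by (auto simp: conj_grid_def intro!: exI[of _ 1])
  then have "conj_grid p (i - 24, j)" "conj_grid p (i - 24, j - 24)"
    using ij conj_grid_trans by blast+
  moreover have "(i - 24, j) \<in> grid" "(i - 24, j - 24) \<in> grid"
    using ij(1) \<open>24 < i\<close> by (auto simp: grid_def; presburger)+
  ultimately have "(i - 24, j) = (i - 24, j - 24)"
    using assms(2) by (auto simp: grid_family_def inj_on_def)
  then show False by simp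
qed

text \<open>
  Some conjugate has the same first component \<open>i\<close> but a different second one. Modulo 24 the second
  component is \<open>c j\<close>, and only two representatives lie below 36.
\<close>
definition has_rival :: "int \<Rightarrow> int \<Rightarrow> bool" where
  "has_rival i j \<longleftrightarrow> list_ex (\<lambda>c. (i - c * i) mod 24 = 0 \<and>
     list_ex (\<lambda>j'. j' \<noteq> j \<and> i < j' \<and> j' < 36) [c * j mod 24, c * j mod 24 + 24]) units_24"

lemma has_rival_not_galois:
  assumes "(i, j) \<in> grid" "has_rival i j"
  shows "\<not> inj_on fst (grid_family (i, j))"
proof -
  obtain c j' where c: "c \<in> set units_24" "24 dvd i - c * i" and j': "j' \<noteq> j" "i < j'" "j' < 36"
      and "j' \<in> set [c * j mod 24, c * j mod 24 + 24]"
    using assms(2) unfolding has_rival_def list_ex_iff mod_eq_0_iff_dvd by blast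
  then have "j' mod 24 = (c * j) mod 24" by auto
  then have "24 dvd j' - c * j" by (simp only: mod_eq_dvd_iff)
  with c have conj: "conj_grid (i, j') (i, j)" unfolding conj_grid_iff_units by blast
  have "(i, j') \<in> grid_family (i, j)"
    using assms(1) j'(2,3) conj_grid_sym[OF conj] conj_grid_dvd_3[OF conj]
    by (auto simp: grid_family_def grid_def)
  moreover have "(i, j) \<in> grid_family (i, j)"
    using assms(1) by (simp add: grid_family_def conj_grid_refl)
  ultimately show ?thesis using j'(1) inj_onD[of fst "grid_family (i, j)" "(i, j')" "(i, j)"] by auto
qed

text \<open>
  The pair \<open>(b, j)\<close> stands for the family of \<open>(1/b, j/24)\<close>.
\<close>
definition galois_reps :: "(int \<times> int) list" where
  "galois_reps =
     [(24, 14), (24, 17), (24, 20), (24, 23), (12, 16), (12, 22),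
      (8, 12), (8, 15), (8, 18), (8, 21), (8, 24), (8, 27),
      (6, 20), (4, 12), (4, 18), (4, 24), (4, 30), (3, 16), (3, 28), (2, 24), (1, 30)]"

lemma galois_rep:
  assumes "m * b = 24" "m > 0" "(m, j) \<in> grid" "inj_on fst (grid_family (m, j))"
  shows "(b, j) \<in> set galois_reps"
proof -
  have "m dvd 24" using assms(1) by (metis dvd_triv_left)
  then have "m \<le> 24" by (simp add: zdvd_imp_le)
  with assms(2) have "m \<in> set [1..24]" by simp
  then have m: "m \<in> {1, 2, 3, 4, 6, 8, 12, 24}"
    using \<open>m dvd 24\<close> by (auto simp: upto.simps simp del: set_upto)
  have "\<forall>m\<in>set [1, 2, 3, 4, 6, 8, 12, 24]. \<forall>j\<in>set [m + 1..35].
      3 dvd m + j \<longrightarrow> (24 div m, j) \<in> set galois_reps \<or> has_rival m j"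
    by code_simp
  moreover have "m \<in> set [1, 2, 3, 4, 6, 8, 12, 24]" using m by simp
  moreover have "3 dvd m + j" "j \<in> set [m + 1..35]" using assms(3) by (auto simp: grid_def)
  ultimately have "(24 div m, j) \<in> set galois_reps \<or> has_rival m j" by blast
  moreover have "24 div m = b" using assms(1,2) by (simp flip: assms(1))
  ultimately show ?thesis using has_rival_not_galois[OF assms(3)] assms(4) by auto
qed

text \<open>
  The numerators \<open>i\<close> of the members \<open>(i/b, j'/24)\<close> in the family of \<open>(1/b, j/24)\<close>. The multiplier
  \<open>c\<close> determines \<open>i\<close> modulo \<open>b\<close>, and a member exists if some \<open>j' \<equiv> c j\<close> fits between the first
  component and 3/2.
\<close>
definition class_list :: "int \<Rightarrow> int \<Rightarrow> int list" where
  "class_list b j = [i \<leftarrow> [0..b - 1]. list_ex (\<lambda>c. c mod b = i \<and>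
     list_ex (\<lambda>j'. (j' - c * j) mod 24 = 0) [i * (24 div b) + 1..35]) units_24]"

lemma class_list_iff:
  assumes b: "b > 1" "m * b = 24" and grid: "(m, j) \<in> grid" and inj: "inj_on fst (grid_family (m, j))"
  shows "i \<in> set (class_list b j) \<longleftrightarrow> (\<exists>j'. (i * m, j') \<in> grid_family (m, j))"
proof -
  have m: "m > 0" "24 div b = m"
    using grid b(1) nonzero_mult_div_cancel_right[of b m] by (auto simp: grid_def b(2))
  have mem_iff: "i \<in> set (class_list b j) \<longleftrightarrow> 0 \<le> i \<and> i < b \<and>
      (\<exists>c\<in>set units_24. c mod b = i \<and> (\<exists>j'. i * m < j' \<and> j' < 36 \<and> 24 dvd j' - c * j))"
  proof -
    have "set [i * m + 1..35] = {j'. i * m < j' \<and> j' < 36}" by auto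
    then show ?thesis
      unfolding class_list_def m(2) set_filter list_ex_iff mod_eq_0_iff_dvd by auto
  qed
  have dvd_iff: "24 dvd i * m - c * m \<longleftrightarrow> b dvd i - c" for c
  proof -
    have "i * m - c * m = m * (i - c)" by (simp add: algebra_simps)
    then show ?thesis using m(1) by (simp flip: b(2))
  qed
  have "m * 1 < m * b" using b(1) m(1) by (intro mult_strict_left_mono) auto
  then have "\<not> 24 dvd m" using m(1) b(2) by (auto dest: zdvd_imp_le)
  then have no24: "\<not> 24 dvd c * m" if "coprime c 24" for c
    using that by (simp add: coprime_dvd_mult_right_iff coprime_commute)
  show ?thesis
  proof
    assume "i \<in> set (class_list b j)"
    then obtain c j' where c: "0 \<le> i" "i < b" "c \<in> set units_24" "c mod b = i" "i * m < j'" "j' < 36" "24 dvd j' - c * j"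
      unfolding mem_iff by blast
    have "i - c = - (b * (c div b))" using c(4) by (simp add: minus_mod_eq_mult_div[symmetric])
    then have "b dvd i - c" by simp
    then have conj: "conj_grid (i * m, j') (m, j)"
 
      using c(3,7) dvd_iff[of c] unfolding conj_grid_iff_units by blast
    have "coprime c 24" using c(3) by (rule units_24_coprime)
    have "i \<noteq> 0"
    proof
      assume "i = 0"
      then have "24 dvd c * m" using \<open>b dvd i - c\<close> dvd_iff[of c] by simp
      with no24[OF \<open>coprime c 24\<close>] show False by simp
    qed
    then have "(i * m, j') \<in> grid"
      using c m conj_grid_dvd_3[OF conj] grid by (auto simp: grid_def)
    then show "\<exists>j'. (i * m, j') \<in> grid_family (m, j)"
      using conj_grid_sym[OF conj] by (auto simp: grid_family_def)
  next
    assume "\<exists>j'. (i * m, j') \<in> grid_family (m, j)"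
    then obtain j' where j': "(i * m, j') \<in> grid" "conj_grid (m, j) (i * m, j')"
      by (auto simp: grid_family_def)
    from conj_grid_sym[OF this(2)] obtain c where c: "c \<in> set units_24" "24 dvd i * m - c * m" "24 dvd j' - c * j"
      by (auto simp: conj_grid_iff_units)
    have cop: "coprime c 24" using c(1) by (rule units_24_coprime)
    have bc: "b dvd i - c" using c(2) dvd_iff by blast
    have "\<not> 24 dvd i * m" using no24[OF cop] dvd_diff[OF _ c(2), of "i * m"] by auto
    then have "i * m < 24"
      using galois_numerator_less[OF grid inj, of "i * m" j'] j' by (simp add: grid_family_def)
    then have "i < b" using b(2) m(1) by (metis mult.commute mult_less_cancel_left_pos)
    moreover have "0 \<le> i" using j'(1) m(1) by (auto simp: grid_def zero_less_mult_iff)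
    moreover have "c mod b = i"
      using bc \<open>i < b\<close> \<open>0 \<le> i\<close> by (metis mod_eq_dvd_iff mod_pos_pos_trivial)
    ultimately show "i \<in> set (class_list b j)"
      unfolding mem_iff using c j'(1) by (auto simp: grid_def)
  qed
qed

lemma class_list_galois_reps:
  "class_list 24 14 = [1, 5, 7, 11, 13, 17, 19, 23]" "class_list 24 17 = [1, 5, 7, 11, 13, 17, 19, 23]"
  "class_list 24 20 = [1, 5, 7, 11, 13, 17, 19, 23]" "class_list 24 23 = [1, 5, 7, 11, 13, 17, 19, 23]"
  "class_list 12 16 = [1, 5, 7, 11]" "class_list 12 22 = [1, 5, 7, 11]"
  "class_list 8 12 = [1, 3]" "class_list 8 15 = [1, 3, 5, 7]" "class_list 8 18 = [1, 3, 5, 7]"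
  "class_list 8 21 = [1, 3, 5, 7]" "class_list 8 24 = [1, 3, 5, 7]" "class_list 8 27 = [1, 3]"
  "class_list 6 20 = [1, 5]" "class_list 4 12 = [1]" "class_list 4 18 = [1, 3]"
  "class_list 4 24 = [1, 3]" "class_list 4 30 = [1]" "class_list 3 16 = [1, 2]"
  "class_list 3 28 = [1, 2]" "class_list 2 24 = [1]"
  by code_simp+

text \<open>
  The other representatives are reflections of those treated above.
\<close>
lemma K2_coeffs_reflected:
  "K2_coeff (1 / 24) (23 / 24) 6 = -28" "K2_coeff (1 / 24) (23 / 24) 9 = -168"
  "K2_coeff (1 / 24) (23 / 24) 20 = 112" "K2_coeff (1 / 24) (5 / 6) 6 = -120"
  "K2_coeff (1 / 24) (5 / 6) 9 = -60" "K2_coeff (1 / 24) (5 / 6) 20 = 720"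
  "K2_coeff (1 / 12) (11 / 12) 7 = 96" "K2_coeff (1 / 12) (11 / 12) 11 = 96"
  "K2_coeff (1 / 8) (9 / 8) 4 = -28" "K2_coeff (1 / 8) 1 8 = 48" "K2_coeff (1 / 8) 1 13 = -192"
  "K2_coeff (1 / 8) (7 / 8) 8 = 80" "K2_coeff (1 / 8) (7 / 8) 13 = -128"
  "K2_coeff (1 / 4) 1 5 = -32" "K2_coeff (1 / 3) (7 / 6) 3 = 16"
  using K2_coeff_reflect[of "1 / 24" "7 / 12"] K2_coeff_reflect[of "1 / 24" "17 / 24"]
    K2_coeff_reflect[of "1 / 12" "2 / 3"] K2_coeff_reflect[of "1 / 8" "1 / 2"]
    K2_coeff_reflect[of "1 / 8" "5 / 8"] K2_coeff_reflect[of "1 / 8" "3 / 4"]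
    K2_coeff_reflect[of "1 / 4" "3 / 4"] K2_coeff_reflect[of "1 / 3" "2 / 3"]
  by (simp_all add: K2_coeffs_24_14 K2_coeffs_24_17 K2_coeffs_12_16 K2_coeffs_8_12 K2_coeffs_8_15
      K2_coeffs_8_18 K2_coeffs_4_18 K2_coeffs_3_16)

lemma generating_data_galois_reps:
  assumes "(b, j) \<in> set galois_reps" "b > 1"
  shows "generating_data (nat b) (nat ` set (class_list b j)) (K2_coeff (1 / of_int b) (of_int j / 24))"
  using assms
  by (auto simp: galois_reps_def class_list_galois_reps K2_coeffs_reflected
      K2_coeffs_24_14 K2_coeffs_24_17 K2_coeffs_12_16 K2_coeffs_8_12 K2_coeffs_8_15
      K2_coeffs_8_18 K2_coeffs_6_20 K2_coeffs_4_18 K2_coeffs_3_16 intro!: generating_data.intros[simplified])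

section \<open>Completed eigenforms of a Galois family\<close>

definition family_classes :: "(rat \<times> rat) set \<Rightarrow> nat \<Rightarrow> nat set" where
  "family_classes F b = {i. \<exists>s. (of_nat i / of_nat b, s) \<in> F}"

definition family_second :: "(rat \<times> rat) set \<Rightarrow> nat \<Rightarrow> nat \<Rightarrow> rat" where
  "family_second F b i = (THE s. (of_nat i / of_nat b, s) \<in> F)"

definition family_coeff :: "(rat \<times> rat) set \<Rightarrow> nat \<Rightarrow> nat \<Rightarrow> nat \<Rightarrow> complex" where
  "family_coeff F b i k = of_rat (K2_coeff (of_nat i / of_nat b) (family_second F b i) k)"

lemma family_secondI:
  assumes "inj_on fst F" "(of_nat i / of_nat b, s) \<in> F"
  shows "family_second F b i = s"
  unfolding family_second_def
proof (rule the_equality)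
  show "t = s" if "(of_nat i / of_nat b, t) \<in> F" for t
    using inj_onD[OF assms(1) _ that assms(2)] by simp
qed (fact assms(2))

lemma generating_data_mono:
  assumes "generating_data b I c" and "\<And>k. c k \<noteq> 0 \<Longrightarrow> d k \<noteq> 0"
  shows "generating_data b I d"
  using assms(1) by (cases rule: generating_data.cases) (simp_all only: assms(2) generating_data.intros not_False_eq_True)

text \<open>
  The family contains \<open>(1/b, s)\<close>, so it is one of the listed families with \<open>24/b\<close> as first
  coordinate on the grid.
\<close>
lemma galois_family_structure:
  assumes gal: "galois_family F" and mem: "(1 / of_nat b, s) \<in> F" and b: "b > 1"
  shows "F = (\<lambda>i. (of_nat i / of_nat b, family_second F b i)) ` family_classes F b"
    and "\<And>i. i \<in> family_classes F b \<Longrightarrow> 0 < i \<and> i < b \<and> coprime i b"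
    and "generating_data b (family_classes F b) (family_coeff F b 1)"
proof -
  obtain q where q: "q \<in> grid" "(1 / of_nat b, s) = grid_pair q" "F = grid_pair ` grid_family q"
      "inj_on fst (grid_family q)"
    using galois_family_cases[OF gal mem] .
  obtain m j where mj: "q = (m, j)" by force
  have "1 / of_nat b = (of_int m / 24 :: rat)" and s: "s = of_int j / 24"
    using q(2) by (simp_all add: mj grid_pair_def)
  then have "of_int (m * int b) = (of_int 24 :: rat)" using b by (simp add: field_simps)
  then have mb: "m * int b = 24" by (simp only: of_int_eq_iff)
  have m0: "m > 0" using q(1) by (simp add: mj grid_def)
  note grid = q(1)[unfolded mj] and inj = q(4)[unfolded mj]
  have injF: "inj_on fst F"
    using inj unfolding q(3) mj inj_on_def by (metis fst_grid_pair_eq_iff imageI inj_grid_pair injD imageE)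
  have b': "int b > 1" using b by simp
  have frac: "of_int (i * m) / 24 = (of_int i / of_nat b :: rat)" for i
  proof -
    have "(of_int m :: rat) * of_nat b = 24" using arg_cong[OF mb, of "of_int :: int \<Rightarrow> rat"] by simp
    then show ?thesis using b by (simp add: field_simps)
  qed
  have mult_m: "\<exists>i. x = i * m" if "(x, y) \<in> grid_family (m, j)" for x y
  proof -
    from that have "conj_grid (x, y) (m, j)" by (auto simp: grid_family_def intro: conj_grid_sym)
    then obtain c where "24 dvd x - c * m" by (auto simp: conj_grid_def)
    then have "m dvd x - c * m" using mb by (metis dvd_mult_left dvd_triv_left dvd_trans)
    then have "m dvd x" by (simp add: dvd_diff_left_iff)
    then show ?thesis by (metis dvdE mult.commute)
  qed
  have classes: "family_classes F b = nat ` set (class_list (int b) j)"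
  proof (intro equalityI subsetI)
    fix i assume "i \<in> family_classes F b"
    then obtain t where "(of_nat i / of_nat b, t) \<in> F" by (auto simp: family_classes_def)
    then obtain x y where xy: "(x, y) \<in> grid_family (m, j)" "of_nat i / of_nat b = (of_int x / 24 :: rat)"
      by (auto simp: q(3) mj grid_pair_def)
    have "of_int (int i * m) / 24 = (of_int x / 24 :: rat)" using frac[of "int i"] xy(2) by simp
    then have "of_int (int i * m) = (of_int x :: rat)" by simp
    then have "x = int i * m" by (simp only: of_int_eq_iff)
    then have "int i \<in> set (class_list (int b) j)"
      using class_list_iff[OF b' mb grid inj] xy(1) by blast
    then show "i \<in> nat ` set (class_list (int b) j)" by force
  next
    fix i assume "i \<in> nat ` set (class_list (int b) j)"
    then obtain k where k: "k \<in> set (class_list (int b) j)" "i = nat k" by blast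
    then have "k \<ge> 0" by (auto simp: class_list_def)
    obtain y where "(k * m, y) \<in> grid_family (m, j)"
      using k(1) class_list_iff[OF b' mb grid inj] by blast
    then have "grid_pair (k * m, y) \<in> F" by (simp add: q(3) mj)
    then show "i \<in> family_classes F b"
      using k(2) \<open>k \<ge> 0\<close> frac[of k] by (auto simp: family_classes_def grid_pair_def of_nat_nat)
  qed
  show "F = (\<lambda>i. (of_nat i / of_nat b, family_second F b i)) ` family_classes F b"
  proof (intro equalityI subsetI)
    fix p assume p: "p \<in> F"
    then obtain x y where xy: "p = grid_pair (x, y)" "(x, y) \<in> grid_family (m, j)"
      by (auto simp: q(3) mj)
    then obtain i where i: "x = i * m" using mult_m by blast
    have "0 < x" using xy(2) by (auto simp: grid_family_def grid_def)
    then have "0 < i" using m0 i by (simp add: zero_less_mult_iff)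
    then have "p = (of_nat (nat i) / of_nat b, of_int y / 24)"
      using frac[of i] by (simp add: xy(1) grid_pair_def i of_nat_nat)
    then show "p \<in> (\<lambda>i. (of_nat i / of_nat b, family_second F b i)) ` family_classes F b"
      using p family_secondI[OF injF] by (force simp: family_classes_def)
  qed (auto simp: family_classes_def family_secondI[OF injF])
  show "0 < i \<and> i < b \<and> coprime i b" if i: "i \<in> family_classes F b" for i
  proof -
    obtain k where k: "k \<in> set (class_list (int b) j)" "i = nat k" using i classes by blast
    then obtain c where c: "c \<in> set units_24" "c mod int b = k" "0 \<le> k" "k < int b"
      by (auto simp: class_list_def list_ex_iff)
    have "coprime c 24" using c(1) by (rule units_24_coprime)
    then have "coprime c (int b)" using mb by (metis coprime_mult_right_iff)
    then have "coprime k (int b)" using c(2) b by auto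
    moreover have "int i = k" using k(2) c(3) by simp
    ultimately have "coprime i b" "i < b" using c(4) by (auto simp flip: coprime_int_iff)
    moreover have "i \<noteq> 0" using \<open>coprime i b\<close> b by (metis coprime_0_left_iff nat_dvd_1_iff_1 less_irrefl)
    ultimately show ?thesis by simp
  qed
  have "generating_data b (family_classes F b) (K2_coeff (1 / of_nat b) s)"
    using generating_data_galois_reps[OF galois_rep[OF mb m0 grid inj]] b by (simp add: classes s)
  moreover have "family_second F b 1 = s" using family_secondI[OF injF, of 1 b s] mem by simp
  ultimately show "generating_data b (family_classes F b) (family_coeff F b 1)"
    by (elim generating_data_mono) (simp add: family_coeff_def)
qed

text \<open>
  All members have denominator \<open>b\<close> and numerators below \<open>b\<close>, so their exponents lie in different
  classes modulo \<open>b\<close> and the sum over the family splits by the class of \<open>n\<close>.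
\<close>
lemma completed_eigenform_hecke_system:
  assumes gal: "galois_family F" and mem: "(1 / of_nat b, s) \<in> F" and b: "b > 1"
    and f: "completed_eigenform F f"
  shows "\<exists>u a. q_expansion f a \<and> hecke_system b (family_classes F b) (family_coeff F b) u a"
proof -
  note struct = galois_family_structure[OF gal mem b]
  define I where "I = family_classes F b"
  define S where "S = family_second F b"
  have F: "F = (\<lambda>i. (of_nat i / of_nat b, S i)) ` I" and I: "\<And>i. i \<in> I \<Longrightarrow> 0 < i \<and> i < b \<and> coprime i b"
    using struct(1,2) by (auto simp: I_def S_def)
  have injF: "inj_on fst F" using gal by (simp add: galois_family_def)
  obtain \<beta> b' s' where \<beta>: "b' > 0" "(1 / of_nat b', s') \<in> F" "\<beta> (1 / of_nat b', s') = (1 :: complex)"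
    and f_eq: "\<And>\<tau>. \<tau> \<in> upper_half_plane \<Longrightarrow> f \<tau> = (\<Sum>p\<in>F. \<beta> p * K2_normalized (fst p) (snd p) \<tau>)"
    and eigen: "hecke_eigenform_away_from_6 3 f"
    using f unfolding completed_eigenform_def by blast
  define u where "u = (\<lambda>i. \<beta> (of_nat i / of_nat b, S i))"
  define a where "a = (\<lambda>n. \<Sum>i\<in>I. u i * of_rat (K2_fourier i b (S i) n))"
  have inj_map: "inj_on (\<lambda>i. (of_nat i / of_nat b :: rat, S i)) I" using b by (auto simp: inj_on_def)
  have finI: "finite I" using I by (intro finite_subset[of I "{..<b}"]) auto
  have "q_expansion f a"
    unfolding q_expansion_def
  proof
    fix \<tau> :: complex assume \<tau>: "\<tau> \<in> upper_half_plane"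
    have "(\<lambda>n. \<Sum>i\<in>I. u i * (of_rat (K2_fourier i b (S i) n) * exp (2 * of_real pi * \<i> * of_nat n * \<tau>)))
        sums (\<Sum>i\<in>I. u i * K2_normalized (of_nat i / of_nat b) (S i) \<tau>)"
      using I b \<tau> by (intro sums_sum sums_mult q_expansionD[OF q_expansion_K2_normalized]) auto
    also have "(\<Sum>i\<in>I. u i * K2_normalized (of_nat i / of_nat b) (S i) \<tau>) = f \<tau>"
      unfolding f_eq[OF \<tau>] by (subst F, subst sum.reindex[OF inj_map]) (simp add: u_def)
    finally show "(\<lambda>n. a n * exp (2 * of_real pi * \<i> * of_nat n * \<tau>)) sums f \<tau>"
      by (simp add: a_def sum_distrib_right mult.assoc)
  qed
  moreover have "hecke_system b I (family_coeff F b) u a"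
  proof
    show one: "1 \<in> I" using mem by (auto simp: I_def family_classes_def)
    show "i \<in> I \<Longrightarrow> i < b" for i using I by blast
    show "family_coeff F b i 0 = 1" for i by (simp add: family_coeff_def)
    \<comment> \<open>The normalization of \<open>\<beta>\<close> could refer to a member with another unit fraction \<open>1/b'\<close>.\<close>
    have "b' = b"
    proof -
      obtain i where i: "i \<in> I" "1 / of_nat b' = (of_nat i / of_nat b :: rat)"
        using \<beta>(2) unfolding F by auto
      then have "of_nat b = (of_nat (i * b') :: rat)" using \<beta>(1) b by (simp add: field_simps)
      then have "b = i * b'" by (simp only: of_nat_eq_iff)
      then have "i dvd b" by simp
      then have "i = 1" using I[OF i(1)] by (metis coprime_common_divisor dvd_refl nat_dvd_1_iff_1)
      with \<open>b = i * b'\<close> show ?thesis by simp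
    qed
    then show "u 1 = 1"
      using \<beta>(2,3) family_secondI[OF injF, of 1 b s'] by (simp add: u_def S_def)
    show coeff: "a n = (if n mod b \<in> I then u (n mod b) * family_coeff F b (n mod b) (n div b) else 0)" for n
    proof -
      have "K2_fourier i b (S i) n = (if i = n mod b then K2_coeff (of_nat i / of_nat b) (S i) (n div b) else 0)"
        if "i \<in> I" for i
      proof (cases "i = n mod b")
        case True
        then have "n - i = b * (n div b)" by (simp add: minus_mod_eq_mult_div)
        then show ?thesis using True b by (simp add: K2_fourier_def)
      next
        case False
        have "\<not> (i \<le> n \<and> b dvd n - i)"
          using False I[OF that] by (metis mod_eq_dvd_iff_nat mod_less)
        then show ?thesis using False by (auto simp: K2_fourier_def)
      qed
      then have "a n = (\<Sum>i\<in>I. if i = n mod b then u i * family_coeff F b i (n div b) else 0)"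
        unfolding a_def family_coeff_def S_def[symmetric] by (intro sum.cong) auto
      then show ?thesis using finI by (simp add: sum.delta')
    qed
    have "a 1 = 1" using one \<open>u 1 = 1\<close> b by (simp add: coeff family_coeff_def)
    show "a (p * n) = a p * a n" if "prime p" "3 < p" "\<not> p dvd n" for p n
    proof (rule hecke_eigenform_coeff_mult[OF \<open>q_expansion f a\<close> eigen \<open>a 1 = 1\<close> that(1) _ that(3)])
      have "\<not> p dvd 6"
      proof
        assume "p dvd 6"
        then have "p dvd 2 * 3" by simp
        then have "p dvd 2 \<or> p dvd 3" using that(1) by (simp only: prime_dvd_mult_iff)
        then show False using that(2) by (auto dest: dvd_imp_le)
      qed
      then show "coprime p 6" using that(1) by (rule prime_imp_coprime[rotated])
    qed
  qed
  ultimately show ?thesis unfolding I_def by blast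
qed

lemma hecke_system_cong:
  assumes "hecke_system b I C u a" "\<And>i k. i \<in> I \<Longrightarrow> C i k = C' i k"
  shows "hecke_system b I C' u a"
proof -
  note S = assms(1)
  show ?thesis
  proof
    show "a n = (if n mod b \<in> I then u (n mod b) * C' (n mod b) (n div b) else 0)" for n
      using hecke_system.coeff[OF S, of n] assms(2) by simp
    show "C' i 0 = 1" if "i \<in> I" for i
      using hecke_system.C_0[OF S that] assms(2)[OF that] by simp
  qed (fact hecke_system.mult[OF S] hecke_system.classes_less[OF S] hecke_system.one_class[OF S]
      hecke_system.u_1[OF S])+
qed

definition reflect_pair :: "rat \<times> rat \<Rightarrow> rat \<times> rat" where
  "reflect_pair = (\<lambda>(r, s). (r, r - s + 3 / 2))"

lemma galois_family_reflect:
  assumes "galois_family F" "p \<in> F"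
  shows "conj_family (reflect_pair p) = reflect_pair ` F" "galois_family (reflect_pair ` F)"
proof -
  obtain q where q: "q \<in> grid" "p = grid_pair q" "F = grid_pair ` grid_family q" "inj_on fst (grid_family q)"
    using galois_family_cases[OF assms] .
  have refl: "grid_pair (reflect q) = reflect_pair (grid_pair q)" for q
    by (cases q) (simp add: grid_pair_reflect reflect_pair_def, simp add: grid_pair_def)
  have F': "grid_pair ` grid_family (reflect q) = reflect_pair ` F"
    by (simp add: grid_family_reflect q(3) image_image refl)
  then show "conj_family (reflect_pair p) = reflect_pair ` F"
    by (simp add: q(2) conj_family_grid_pair flip: refl)
  show "galois_family (reflect_pair ` F)"
    using galois_familyI[OF reflect_in_grid[OF q(1)]] q(4) by (simp add: inj_on_fst_reflect F')
qed

lemma reflect_pair_mem_iff: "(r, r - s + 3 / 2) \<in> reflect_pair ` F \<longleftrightarrow> (r, s) \<in> F"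
  by (force simp: reflect_pair_def image_iff)

lemma family_classes_reflect: "family_classes (reflect_pair ` F) b = family_classes F b"
  by (force simp: family_classes_def reflect_pair_def image_iff)

lemma family_coeff_reflect:
  assumes gal: "galois_family F" "galois_family (reflect_pair ` F)" and i: "i \<in> family_classes F b"
  shows "family_coeff (reflect_pair ` F) b i k = (- 1) ^ k * family_coeff F b i k"
proof -
  obtain s where s: "(of_nat i / of_nat b, s) \<in> F" using i by (auto simp: family_classes_def)
  then have "(of_nat i / of_nat b, of_nat i / of_nat b - s + 3 / 2) \<in> reflect_pair ` F"
    by (simp add: reflect_pair_mem_iff)
  then have "family_second (reflect_pair ` F) b i = of_nat i / of_nat b - s + 3 / 2" "family_second F b i = s"
    using s gal by (auto intro!: family_secondI simp: galois_family_def)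
  then show ?thesis
    by (simp add: family_coeff_def K2_coeff_reflect of_rat_mult of_rat_power of_rat_minus)
qed

section \<open>The twisting theorem\<close>

theorem completed_eigenforms_twist:
  assumes gal: "galois_family F" and mem: "(1 / of_nat b, s) \<in> F" and b: "b > 1"
    and f: "completed_eigenform F f" "completed_eigenform (reflect_pair ` F) f'"
  shows "\<exists>m chi. dirichlet_character m chi \<and>
    (b \<noteq> 3 \<longrightarrow> (\<forall>\<tau>\<in>upper_half_plane. f \<tau> = twist chi f' \<tau>)) \<and>
    (b = 3 \<longrightarrow> (\<forall>n. fourier_coeff 1 f n = (if odd n then 1 else - 1) * chi (int n) * fourier_coeff 1 f' n))"
proof -
  define I where "I = family_classes F b"
  define C where "C = family_coeff F b"
  note gal' = galois_family_reflect(2)[OF gal mem]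
  have mem': "(1 / of_nat b, 1 / of_nat b - s + 3 / 2) \<in> reflect_pair ` F"
    using mem by (simp add: reflect_pair_mem_iff)
  have gen: "generating_data b I (C 1)"
    using galois_family_structure(3)[OF gal mem b] by (simp add: I_def C_def)
  have cop: "coprime i b" if "i \<in> I" for i
    using galois_family_structure(2)[OF gal mem b] that by (simp add: I_def)
  obtain u a where a: "q_expansion f a" "hecke_system b I C u a"
    using completed_eigenform_hecke_system[OF gal mem b f(1)] by (auto simp: I_def C_def)
  obtain u' a' where a': "q_expansion f' a'"
      "hecke_system b I (family_coeff (reflect_pair ` F) b) u' a'"
    using completed_eigenform_hecke_system[OF gal' mem' b f(2)]
    unfolding family_classes_reflect I_def by blast
  have S': "hecke_system b I (\<lambda>i k. (- 1) ^ k * C i k) u' a'"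
    by (rule hecke_system_cong[OF a'(2)]) (simp add: C_def I_def family_coeff_reflect[OF gal gal'])
  note fc = fourier_coeff_q_expansion[OF a(1)] fourier_coeff_q_expansion[OF a'(1)]
  show ?thesis
  proof (cases "b = 3")
    case True
    then have "I = {1, 2}" "C 1 3 \<noteq> 0" using gen by (auto elim: generating_data.cases)
    then obtain chi where "dirichlet_character 3 chi"
        "\<And>n. a n = (if odd n then 1 else - 1) * chi (int n) * a' n"
      using dirichlet_character_mod_3[of C u a u' a'] a(2) S' True by blast
    then show ?thesis using True unfolding fc by blast
  next
    case False
    then have "even b" using gen by (auto elim: generating_data.cases)
    have gen': "generating_data b I (\<lambda>k. (- 1) ^ k * C 1 k)"
      using gen by (rule generating_data_mono) simp
    have R: "reflected_hecke_systems b I C u a u' a'"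
    proof (intro reflected_hecke_systems.intro reflected_hecke_systems_axioms.intro a(2) S' \<open>even b\<close>)
      show "odd i" if "i \<in> I" for i
        using cop[OF that] \<open>even b\<close> by (metis coprime_common_divisor odd_one)
    qed (rule hecke_system.u_nonzero_of_generating_data[OF a(2) gen]
          hecke_system.u_nonzero_of_generating_data[OF S' gen'], assumption)+
    define chi where "chi = reflected_hecke_systems.chi b I u u'"
    have character: "dirichlet_character (2 * b) chi"
      unfolding chi_def by (rule reflected_hecke_systems.dirichlet_character_chi_of_generating_data[OF R gen])
    have coeff: "a n = chi (int n) * a' n" for n
      unfolding chi_def by (rule reflected_hecke_systems.coeff_eq_chi[OF R])
    have "f \<tau> = twist chi f' \<tau>" if "\<tau> \<in> upper_half_plane" for \<tau>
      by (rule twist_eq[OF a(1) a'(1) coeff that])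
    then show ?thesis
      using character False by blast
  qed
qed

text \<open>
  The only Galois family with \<open>b = 1\<close> is that of \<open>(1, 5/4)\<close>. It has one member, which is its own
  reflection, and the normalization leaves no choice for the eigenform.
\<close>
lemma completed_eigenforms_integral_family:
  assumes gal: "galois_family F" and mem: "(1, s) \<in> F"
    and f: "completed_eigenform F f" "completed_eigenform (reflect_pair ` F) f'"
    and \<tau>: "\<tau> \<in> upper_half_plane"
  shows "F = {(1, 5 / 4)}" and "f \<tau> = twist (\<lambda>_. 1) f' \<tau>"
proof -
  obtain q where q: "q \<in> grid" "(1, s) = grid_pair q" "F = grid_pair ` grid_family q"
      "inj_on fst (grid_family q)"
    using galois_family_cases[OF gal mem] .
  obtain m j where mj: "q = (m, j)" by force
  have "1 = (of_int m / 24 :: rat)" and s: "s = of_int j / 24"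
    using q(2) by (simp_all add: mj grid_pair_def)
  then have "of_int m = (of_int 24 :: rat)" by simp
  then have m: "m = 24" by (simp only: of_int_eq_iff)
  have "(1, j) \<in> set galois_reps" using galois_rep[of 24 1 j] q by (simp add: mj m)
  then have j: "j = 30" by (auto simp: galois_reps_def)
  have "p = (24, 30)" if "p \<in> grid_family (24, 30)" for p
  proof -
    obtain x y where p: "p = (x, y)" by force
    have "conj_grid (x, y) (24, 30)" using that by (auto simp: p grid_family_def intro: conj_grid_sym)
    then obtain c where "24 dvd x - c * 24" by (auto simp: conj_grid_def)
    then have "24 dvd x" by (simp add: dvd_diff_left_iff)
    moreover have "0 < x" "x < 36" using that by (auto simp: p grid_family_def grid_def)
    ultimately have "x = 24" by presburger
    moreover have "(24, 30) \<in> grid_family (24, 30)" using q(1) by (simp add: grid_family_def conj_grid_refl mj m j)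
    ultimately show ?thesis
      using inj_onD[OF q(4)[unfolded mj m j], of p "(24, 30)"] that by (simp add: p)
  qed
  then have "grid_family (24, 30) = {(24, 30)}"
    using q(1) by (auto simp: grid_family_def conj_grid_refl mj m j)
  then show F: "F = {(1, 5 / 4)}" by (simp add: q(3) mj m j grid_pair_def)
  then have F': "reflect_pair ` F = {(1, 5 / 4)}" by (simp add: reflect_pair_def)
  have K2: "g \<tau> = K2_normalized 1 (5 / 4) \<tau>"
    if g: "completed_eigenform G g" and G: "G = {(1, 5 / 4)}" and \<tau>: "\<tau> \<in> upper_half_plane" for G g \<tau>
  proof -
    obtain \<beta> b' s' where \<beta>: "(1 / of_nat b', s') \<in> G" "\<beta> (1 / of_nat b', s') = 1"
        "\<And>\<tau>. \<tau> \<in> upper_half_plane \<Longrightarrow> g \<tau> = (\<Sum>p\<in>G. \<beta> p * K2_normalized (fst p) (snd p) \<tau>)"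
      using g unfolding completed_eigenform_def by blast
    from \<beta>(1,2) have "\<beta> (1, 5 / 4) = 1" by (simp only: G singleton_iff)
    then show ?thesis using \<beta>(3)[OF \<tau>] by (simp add: G)
  qed
  have exp: "q_expansion (K2_normalized 1 (5 / 4)) (\<lambda>n. of_rat (K2_fourier 1 1 (5 / 4) n))"
    using q_expansion_K2_normalized[of 1 1 "5 / 4"] by simp
  have "q_expansion g (\<lambda>n. of_rat (K2_fourier 1 1 (5 / 4) n))" if "completed_eigenform {(1, 5 / 4)} g" for g
    using exp K2[OF that refl] by (simp add: q_expansion_def)
  from twist_eq[OF this[OF f(1)[unfolded F]] this[OF f(2)[unfolded F']] _ \<tau>]
  show "f \<tau> = twist (\<lambda>_. 1) f' \<tau>" by simp
qed

theorem theorem1p4: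
  fixes r s h :: rat
  assumes "0 < r" and "r < s" and "s < 3 / 2"
    and h: "h = r - s + 3 / 2"
    and "0 < h" and "h < 3 / 2"
  shows "(\<forall>n>0. fourier_coeff (K2_width r) (K2 r s) n = fourier_coeff (K2_width r) (K2 r h) n \<or>
                fourier_coeff (K2_width r) (K2 r s) n = - fourier_coeff (K2_width r) (K2 r h) n) \<and>
         (\<forall>F. galois_family F \<and> (r, s) \<in> F \<longrightarrow>
            galois_family (conj_family (r, h)) \<and> (r, h) \<in> conj_family (r, h) \<and>
            (\<forall>f f'. completed_eigenform F f \<and> completed_eigenform (conj_family (r, h)) f' \<longrightarrow>
               (\<exists>m chi. dirichlet_character m chi \<and>
                  (rat_denom r \<noteq> 3 \<longrightarrow> (\<forall>\<tau>\<in>upper_half_plane. f \<tau> = twist chi f' \<tau>)) \<and>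
                  (rat_denom r = 3 \<longrightarrow> (\<forall>n. fourier_coeff 1 f n =
                     (if odd n then 1 else - 1) * chi (int n) * fourier_coeff 1 f' n)))))"
proof (intro conjI allI impI)
  fix n :: nat
  show "fourier_coeff (K2_width r) (K2 r s) n = fourier_coeff (K2_width r) (K2 r h) n \<or>
        fourier_coeff (K2_width r) (K2 r s) n = - fourier_coeff (K2_width r) (K2 r h) n"
    unfolding h using \<open>0 < r\<close> by (rule fourier_coeff_K2_reflect)
next
  fix F assume "galois_family F \<and> (r, s) \<in> F"
  then have gal: "galois_family F" and mem: "(r, s) \<in> F" by auto
  have refl: "(r, h) = reflect_pair (r, s)" by (simp add: reflect_pair_def h)
  note conj = galois_family_reflect[OF gal mem, folded refl]
  show "galois_family (conj_family (r, h))" and "(r, h) \<in> conj_family (r, h)"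
    using conj mem by (auto simp: refl)
  fix f f' assume "completed_eigenform F f \<and> completed_eigenform (conj_family (r, h)) f'"
  then have f: "completed_eigenform F f" "completed_eigenform (reflect_pair ` F) f'"
    using conj(1) by auto
  then obtain b s\<^sub>1 where b: "b > 0" "(1 / of_nat b, s\<^sub>1) \<in> F"
    unfolding completed_eigenform_def by blast
  show "\<exists>m chi. dirichlet_character m chi \<and>
                  (rat_denom r \<noteq> 3 \<longrightarrow> (\<forall>\<tau>\<in>upper_half_plane. f \<tau> = twist chi f' \<tau>)) \<and>
                  (rat_denom r = 3 \<longrightarrow> (\<forall>n. fourier_coeff 1 f n =
                     (if odd n then 1 else - 1) * chi (int n) * fourier_coeff 1 f' n))"
  proof (cases "b = 1")
    case True
    then have mem1: "(1, s\<^sub>1) \<in> F" using b by simp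
    have "\<i> \<in> upper_half_plane" by (simp add: upper_half_plane_def)
    from completed_eigenforms_integral_family(1)[OF gal mem1 f this] mem have "r = 1" by simp
    then have "rat_denom r = 1" using rat_denom_of_nat_divide[of 1 1] by simp
    moreover have "dirichlet_character 1 (\<lambda>_. 1)" by (simp add: dirichlet_character_def)
    ultimately show ?thesis
      using completed_eigenforms_integral_family(2)[OF gal mem1 f] by auto
  next
    case False
    with b have "b > 1" by simp
    from mem galois_family_structure(1,2)[OF gal b(2) this]
    obtain i where "r = of_nat i / of_nat b" "coprime i b" by blast
    then have "rat_denom r = b" using b(1) by (simp add: rat_denom_of_nat_divide)
    then show ?thesis
      using completed_eigenforms_twist[OF gal b(2) \<open>b > 1\<close> f] by simp
  qed
qed

end
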